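(* Let $(B,g_B)$ and $(F,g_F)$ be semi-Riemannian manifolds, let $f:B\to\mathbb{R}$ be a smooth positive function, and let $M=B\times_fF$ be the warped product with metric $\widetilde g=g_B+f^2g_F$. If $(M,\widetilde g)$ is a gradient Ricci soliton with potential function $h:B\to\mathbb{R}$ (a function depending only on the base, regarded as a function on $M$ via the projection $M\to B$), and $f$ is non-constant, then the fiber $(F,g_F)$ is an Einstein manifold.
   Context: A semi-Riemannian manifold $(M,g)$ of dimension at least $3$ is a gradient Ricci soliton if there exist a smooth function $h:M\to\mathbb{R}$ (the potential function) and a constant $\rho\in\mathbb{R}$ with $\mathrm{Ric}_g+\mathrm{Hess}_g(h)=\rho g$; completeness is not required. For semi-Riemannian manifolds $(B,g_B)$ (base), $(F,g_F)$ (fiber) and a smooth function $f>0$ on $B$ (warping function), the warped product $B\times_fF$ is the product manifold $B\times F$ with metric $\widetilde g=g_B+f^2g_F$. Einstein means $\mathrm{Ric}_{g_F}=\lambda g_F$ for a constant $\lambda\in\mathbb{R}$. *)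

theory Defs
  imports "HOL-Analysis.Analysis"
begin

section \<open>Smooth maps between open subsets of Euclidean spaces\<close>

text \<open>
  The derivative at a point is taken in the whole space, so these two notions are
  meaningful for open \<open>S\<close> only; they are used for no other \<open>S\<close>.
\<close>

primrec Ck_on :: "nat \<Rightarrow> ('a::euclidean_space \<Rightarrow> 'b::real_normed_vector) \<Rightarrow> 'a set \<Rightarrow> bool" where
  "Ck_on 0 f S \<longleftrightarrow> continuous_on S f"
| "Ck_on (Suc k) f S \<longleftrightarrow> (\<forall>x\<in>S. f differentiable (at x)) \<and>
     (\<forall>v. Ck_on k (\<lambda>x. frechet_derivative f (at x) v) S)"

definition smooth_on :: "'a::euclidean_space set \<Rightarrow> ('a \<Rightarrow> 'b::real_normed_vector) \<Rightarrow> bool" where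
  "smooth_on S f \<longleftrightarrow> (\<forall>k. Ck_on k f S)"


section \<open>Smooth manifolds\<close>

text \<open>
  The points of a manifold are all elements of a type \<open>'p\<close> whose topology is Hausdorff and
  second countable. The smooth structure is the one generated by an atlas of charts into a
  Euclidean space \<open>'e\<close>, so the dimension of the manifold is \<open>DIM('e)\<close>. The atlas need not be
  maximal. No connectedness is required.

  A chart is a pair of an open set of points and a coordinate map; the values of the
  coordinate map outside that set are irrelevant.
\<close>

type_synonym ('p, 'e) chart = "'p set \<times> ('p \<Rightarrow> 'e)"

definition chart_dom :: "('p, 'e) chart \<Rightarrow> 'p set" where
  "chart_dom c = fst c"

definition chart_map :: "('p, 'e) chart \<Rightarrow> 'p \<Rightarrow> 'e" where
  "chart_map c = snd c"

definition chart_inv :: "('p, 'e) chart \<Rightarrow> 'e \<Rightarrow> 'p" where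
  "chart_inv c = inv_into (chart_dom c) (chart_map c)"

definition is_chart :: "('p::topological_space, 'e::euclidean_space) chart \<Rightarrow> bool" where
  "is_chart c \<longleftrightarrow> open (chart_dom c) \<and> open (chart_map c ` chart_dom c) \<and>
     homeomorphism (chart_dom c) (chart_map c ` chart_dom c) (chart_map c) (chart_inv c)"

definition smooth_atlas ::
    "('p::{t2_space, second_countable_topology}, 'e::euclidean_space) chart set \<Rightarrow> bool" where
  "smooth_atlas A \<longleftrightarrow> (\<forall>c\<in>A. is_chart c) \<and> (\<Union>c\<in>A. chart_dom c) = UNIV \<and>
     (\<forall>c\<in>A. \<forall>d\<in>A. smooth_on (chart_map c ` (chart_dom c \<inter> chart_dom d))
                              (chart_map d \<circ> chart_inv c))"

definition smooth_fun :: "('p, 'e::euclidean_space) chart set \<Rightarrow> ('p \<Rightarrow> real) \<Rightarrow> bool" where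
  "smooth_fun A f \<longleftrightarrow> (\<forall>c\<in>A. smooth_on (chart_map c ` chart_dom c) (f \<circ> chart_inv c))"

definition smooth_near ::
    "('p::topological_space, 'e::euclidean_space) chart set \<Rightarrow> 'p \<Rightarrow> ('p \<Rightarrow> real) \<Rightarrow> bool" where
  "smooth_near A p f \<longleftrightarrow> (\<exists>W. open W \<and> p \<in> W \<and>
     (\<forall>c\<in>A. smooth_on (chart_map c ` (chart_dom c \<inter> W)) (f \<circ> chart_inv c)))"


section \<open>Tangent vectors\<close>

text \<open>
  A tangent vector at \<open>p\<close> is a derivation on the functions that are smooth near \<open>p\<close>, totalised
  by \<open>0\<close> on all other functions. \<open>coord_vec A c p u\<close> is the coordinate vector
  \<open>\<Sum>\<^sub>i u\<^sup>i \<partial>/\<partial>x\<^sup>i\<close> at \<open>p\<close> of the chart \<open>c\<close>. With the totalisation, the same derivation given in two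
  charts is the same HOL function.
\<close>

type_synonym 'p tvec = "('p \<Rightarrow> real) \<Rightarrow> real"

definition coord_vec :: "('p::topological_space, 'e::euclidean_space) chart set \<Rightarrow>
    ('p, 'e) chart \<Rightarrow> 'p \<Rightarrow> 'e \<Rightarrow> 'p tvec" where
  "coord_vec A c p u = (\<lambda>f. if smooth_near A p f
     then frechet_derivative (f \<circ> chart_inv c) (at (chart_map c p)) u else 0)"

definition tangent_space ::
    "('p::topological_space, 'e::euclidean_space) chart set \<Rightarrow> 'p \<Rightarrow> 'p tvec set" where
  "tangent_space A p = {coord_vec A c p u | c u. c \<in> A \<and> p \<in> chart_dom c}"

text \<open>The differential of a map \<open>\<pi>\<close>, in terms of derivations.\<close>

definition push_forward :: "('p \<Rightarrow> 'q) \<Rightarrow> 'p tvec \<Rightarrow> 'q tvec" where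
  "push_forward \<pi> X = (\<lambda>f. X (f \<circ> \<pi>))"


section \<open>Semi-Riemannian metrics\<close>

text \<open>Only the values \<open>g p X Y\<close> for \<open>X, Y\<close> tangent at \<open>p\<close> matter.\<close>

type_synonym 'p metric = "'p \<Rightarrow> 'p tvec \<Rightarrow> 'p tvec \<Rightarrow> real"

text \<open>The components of a metric in a chart, as a field of bilinear forms on the model space.\<close>

definition metric_in :: "('p::topological_space, 'e::euclidean_space) chart set \<Rightarrow> 'p metric \<Rightarrow>
    ('p, 'e) chart \<Rightarrow> 'e \<Rightarrow> 'e \<Rightarrow> 'e \<Rightarrow> real" where
  "metric_in A g c x u v =
     (let p = chart_inv c x in g p (coord_vec A c p u) (coord_vec A c p v))"

text \<open>The largest dimension of a subspace on which the form is negative definite.\<close>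

definition form_index :: "('e::euclidean_space \<Rightarrow> 'e \<Rightarrow> real) \<Rightarrow> nat" where
  "form_index b = Max {dim W | W. subspace W \<and> (\<forall>w\<in>W. w \<noteq> 0 \<longrightarrow> b w w < 0)}"

definition semi_riemannian ::
    "('p::{t2_space, second_countable_topology}, 'e::euclidean_space) chart set \<Rightarrow>
      'p metric \<Rightarrow> bool" where
  "semi_riemannian A g \<longleftrightarrow> smooth_atlas A \<and>
     \<comment> \<open>symmetric, bilinear and nondegenerate on each tangent space\<close>
     (\<forall>p. \<forall>X\<in>tangent_space A p. \<forall>Y\<in>tangent_space A p. g p X Y = g p Y X) \<and>
     (\<forall>p. \<forall>X\<in>tangent_space A p. \<forall>Y\<in>tangent_space A p. \<forall>Z\<in>tangent_space A p. \<forall>a b.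
        g p (\<lambda>f. a * X f + b * Y f) Z = a * g p X Z + b * g p Y Z) \<and>
     (\<forall>p. \<forall>X\<in>tangent_space A p. (\<forall>Y\<in>tangent_space A p. g p X Y = 0) \<longrightarrow> X = (\<lambda>_. 0)) \<and>
     \<comment> \<open>smooth\<close>
     (\<forall>c\<in>A. \<forall>u v. smooth_on (chart_map c ` chart_dom c) (\<lambda>x. metric_in A g c x u v)) \<and>
     \<comment> \<open>of constant index\<close>
     (\<exists>\<nu>. \<forall>c\<in>A. \<forall>x\<in>chart_map c ` chart_dom c. form_index (metric_in A g c x) = \<nu>)"


section \<open>Levi-Civita connection, Ricci tensor and Hessian in a chart\<close>

text \<open>
  In this section \<open>G\<close> is a field of bilinear forms on the model space, to be instantiated by
  \<open>metric_in A g c\<close>. Vectors \<open>u, v, w\<close> of the model space stand for the vector fields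
  \<open>\<Sum>\<^sub>i u\<^sup>i \<partial>/\<partial>x\<^sup>i\<close> with constant coefficients, which commute.
\<close>

definition dir_deriv ::
    "('e::euclidean_space \<Rightarrow> 'b::real_normed_vector) \<Rightarrow> 'e \<Rightarrow> 'e \<Rightarrow> 'b" where
  "dir_deriv f x u = frechet_derivative f (at x) u"

text \<open>
  \<open>christoffel G x u v\<close> is the covariant derivative of \<open>v\<close> along \<open>u\<close>, i.e. the vector
  \<open>\<Sum>\<^sub>k \<Gamma>\<^sup>k\<^sub>i\<^sub>j u\<^sup>i v\<^sup>j\<close>, given by the Koszul formula.
\<close>

definition christoffel ::
    "('e::euclidean_space \<Rightarrow> 'e \<Rightarrow> 'e \<Rightarrow> real) \<Rightarrow> 'e \<Rightarrow> 'e \<Rightarrow> 'e \<Rightarrow> 'e" where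
  "christoffel G x u v = (THE z. \<forall>w. 2 * G x z w =
     dir_deriv (\<lambda>y. G y v w) x u + dir_deriv (\<lambda>y. G y u w) x v - dir_deriv (\<lambda>y. G y u v) x w)"

text \<open>
  \<open>R(u,v)w = \<nabla>\<^sub>u \<nabla>\<^sub>v w - \<nabla>\<^sub>v \<nabla>\<^sub>u w\<close>, and \<open>Ric(v,w)\<close> is the trace of \<open>u \<mapsto> R(u,v)w\<close>
  (so that round spheres have positive Ricci curvature).
\<close>

definition curvature ::
    "('e::euclidean_space \<Rightarrow> 'e \<Rightarrow> 'e \<Rightarrow> real) \<Rightarrow> 'e \<Rightarrow> 'e \<Rightarrow> 'e \<Rightarrow> 'e \<Rightarrow> 'e" where
  "curvature G x u v w =
     dir_deriv (\<lambda>y. christoffel G y v w) x u + christoffel G x u (christoffel G x v w)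
     - dir_deriv (\<lambda>y. christoffel G y u w) x v - christoffel G x v (christoffel G x u w)"

definition ricci :: "('e::euclidean_space \<Rightarrow> 'e \<Rightarrow> 'e \<Rightarrow> real) \<Rightarrow> 'e \<Rightarrow> 'e \<Rightarrow> 'e \<Rightarrow> real" where
  "ricci G x v w = (\<Sum>e\<in>Basis. curvature G x e v w \<bullet> e)"

text \<open>\<open>Hess(h)(u,v) = u(v(h)) - (\<nabla>\<^sub>u v)(h)\<close>\<close>

definition hessian ::
    "('e::euclidean_space \<Rightarrow> 'e \<Rightarrow> 'e \<Rightarrow> real) \<Rightarrow> ('e \<Rightarrow> real) \<Rightarrow> 'e \<Rightarrow> 'e \<Rightarrow> 'e \<Rightarrow> real" where
  "hessian G h x u v =
     dir_deriv (\<lambda>y. dir_deriv h y v) x u - dir_deriv h x (christoffel G x u v)"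


section \<open>Einstein manifolds, gradient Ricci solitons, warped products\<close>

text \<open>
  The two tensor equations below are stated in every chart of the atlas; since the charts cover
  the manifold and the sides are tensors, this is the equation on all tangent vectors.
\<close>

definition einstein ::
    "('p::{t2_space, second_countable_topology}, 'e::euclidean_space) chart set \<Rightarrow>
      'p metric \<Rightarrow> bool" where
  "einstein A g \<longleftrightarrow> semi_riemannian A g \<and>
     (\<exists>k. \<forall>c\<in>A. \<forall>x\<in>chart_map c ` chart_dom c. \<forall>u v.
        ricci (metric_in A g c) x u v = k * metric_in A g c x u v)"

definition gradient_ricci_soliton ::
    "('p::{t2_space, second_countable_topology}, 'e::euclidean_space) chart set \<Rightarrow>
      'p metric \<Rightarrow> ('p \<Rightarrow> real) \<Rightarrow> bool" where
  "gradient_ricci_soliton A g h \<longleftrightarrow> semi_riemannian A g \<and> DIM('e) \<ge> 3 \<and> smooth_fun A h \<and>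
     (\<exists>\<rho>. \<forall>c\<in>A. \<forall>x\<in>chart_map c ` chart_dom c. \<forall>u v.
        ricci (metric_in A g c) x u v + hessian (metric_in A g c) (h \<circ> chart_inv c) x u v
          = \<rho> * metric_in A g c x u v)"

definition prod_chart :: "('b, 'e) chart \<Rightarrow> ('q, 'k) chart \<Rightarrow> ('b \<times> 'q, 'e \<times> 'k) chart" where
  "prod_chart c d = (chart_dom c \<times> chart_dom d, map_prod (chart_map c) (chart_map d))"

definition prod_atlas ::
    "('b, 'e) chart set \<Rightarrow> ('q, 'k) chart set \<Rightarrow> ('b \<times> 'q, 'e \<times> 'k) chart set" where
  "prod_atlas A A' = {prod_chart c d | c d. c \<in> A \<and> d \<in> A'}"

definition warped_metric ::
    "'b metric \<Rightarrow> ('b \<Rightarrow> real) \<Rightarrow> 'q metric \<Rightarrow> ('b \<times> 'q) metric" where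
  "warped_metric gB f gF p X Y =
     gB (fst p) (push_forward fst X) (push_forward fst Y)
     + (f (fst p))\<^sup>2 * gF (snd p) (push_forward snd X) (push_forward snd Y)"

end

theory Submission
  imports Defs
begin

text \<open>
  On vertical vectors the Ricci tensor of the warped product is \<open>Ric\<^sub>F + c g\<^sub>F\<close> and the Hessian of
  the potential is \<open>c' g\<^sub>F\<close>, where \<open>c\<close> and \<open>c'\<close> depend on the base point only. At a fixed base point
  the soliton equation thus reads \<open>Ric\<^sub>F = k g\<^sub>F\<close> with a number \<open>k\<close> that is the same at all points
  of the fiber.
\<close>

section \<open>Calculus on open subsets of Euclidean spaces\<close>

text \<open>The warping function enters the coordinate formulas through its square \<phi> = f^2, in
  which the metric is linear. Rewritten in f, with the gradient, Laplacian and inner product of the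
  base metric and n the dimension of the fiber, the coefficients are c = - f Delta f - (n - 1) |grad
  f|^2 and c' = f <grad h, grad f>. Two obstacles shape the proof. \<open>christoffel\<close> is a
  definite description, so the derivative that \<open>curvature\<close> takes of it is meaningful
  only after a differentiability argument for solutions of linear equations with a nondegenerate,
  possibly indefinite form. And a tangent vector is totalised by 0 on functions that are not smooth
  near its point, so a projection maps coordinate vectors to coordinate vectors only if a function
  and its lift to the product are smooth near corresponding points at the same time; one direction
  of this equivalence restricts the lift to a slice.\<close>

lemma frechet_derivative_cong_open:
  assumes "open S" "x \<in> S" "\<And>y. y \<in> S \<Longrightarrow> f y = g y"
  shows "frechet_derivative f (at x) = frechet_derivative g (at x)"
proof -
  have "(f has_derivative D) (at x) \<longleftrightarrow> (g has_derivative D) (at x)" for D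
    using assms by (metis has_derivative_transform_within_open)
  then show ?thesis
    by (simp add: frechet_derivative_def)
qed

lemma dir_deriv_cong_open:
  assumes "open S" "x \<in> S" "\<And>y. y \<in> S \<Longrightarrow> f y = g y"
  shows "dir_deriv f x u = dir_deriv g x u"
  using frechet_derivative_cong_open[OF assms] by (simp add: dir_deriv_def)

lemma differentiable_cong_open:
  assumes "open S" "x \<in> S" "\<And>y. y \<in> S \<Longrightarrow> f y = g y" "g differentiable (at x)"
  shows "f differentiable (at x)"
  using assms unfolding differentiable_def by (metis has_derivative_transform_within_open)

lemma dir_deriv_eqI: "(f has_derivative D) (at x) \<Longrightarrow> dir_deriv f x u = D u"
  by (metis dir_deriv_def frechet_derivative_at)

lemma has_derivative_dir_deriv:
  "f differentiable (at x) \<Longrightarrow> (f has_derivative dir_deriv f x) (at x)"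
  unfolding dir_deriv_def[abs_def] using frechet_derivative_works by blast

lemma linear_dir_deriv: "f differentiable (at x) \<Longrightarrow> linear (dir_deriv f x)"
  using has_derivative_dir_deriv has_derivative_linear by blast

section \<open>Stability of the classes C^k under composition with affine and linear maps\<close>

lemma Ck_on_cong:
  "open S \<Longrightarrow> (\<And>x. x \<in> S \<Longrightarrow> f x = g x) \<Longrightarrow> Ck_on k g S \<Longrightarrow> Ck_on k f S"
proof (induction k arbitrary: f g)
  case 0
  then show ?case by (metis Ck_on.simps(1) continuous_on_cong)
next
  case (Suc k)
  show ?case
    unfolding Ck_on.simps
  proof (intro conjI ballI allI)
    fix x assume "x \<in> S"
    then show "f differentiable (at x)"
      using Suc.prems differentiable_cong_open[of S x f g] by simp
  next
    fix v
    have "Ck_on k (\<lambda>x. frechet_derivative g (at x) v) S"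
      using Suc.prems by simp
    then show "Ck_on k (\<lambda>x. frechet_derivative f (at x) v) S"
      using Suc.IH[of "\<lambda>x. frechet_derivative f (at x) v" "\<lambda>x. frechet_derivative g (at x) v"]
        frechet_derivative_cong_open[of S _ f g] Suc.prems by metis
  qed
qed

text \<open>Since the derivative \<open>L\<close> of \<open>g\<close> is the same at all points, the
  derivative of \<open>f \<circ> g\<close> along \<open>v\<close> is the derivative of
  \<open>f\<close> along \<open>L v\<close>, composed with \<open>g\<close>. This has the same shape
  again, so the induction closes without a product rule. Projections and inclusions of slices are
  the maps of this kind that occur.\<close>

lemma Ck_on_compose_affine:
  fixes L :: "'a::euclidean_space \<Rightarrow> 'b::euclidean_space"
  assumes g: "\<And>x. (g has_derivative L) (at x)" and T: "open T" and gT: "g ` T \<subseteq> S"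
  shows "Ck_on k f S \<Longrightarrow> Ck_on k (f \<circ> g) T"
proof (induction k arbitrary: f)
  case 0
  have "continuous_on T g"
    by (meson continuous_at_imp_continuous_on g has_derivative_continuous)
  then show ?case
    using 0 gT continuous_on_compose[of T g f] continuous_on_subset by (metis Ck_on.simps(1))
next
  case (Suc k)
  have D: "((f \<circ> g) has_derivative (frechet_derivative f (at (g x)) \<circ> L)) (at x)"
    if "x \<in> T" for x
    using that Suc.prems gT diff_chain_at[OF g, of f "frechet_derivative f (at (g x))" x]
    by (auto simp: frechet_derivative_works image_subset_iff)
  show ?case
    unfolding Ck_on.simps
  proof (intro conjI ballI allI)
    fix x assume "x \<in> T"
    then show "(f \<circ> g) differentiable (at x)"
      using D by (auto simp: differentiable_def)
  next
    fix v
    have "Ck_on k ((\<lambda>y. frechet_derivative f (at y) (L v)) \<circ> g) T"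
      using Suc.prems by (intro Suc.IH) simp
    moreover have "frechet_derivative (f \<circ> g) (at x) v
        = ((\<lambda>y. frechet_derivative f (at y) (L v)) \<circ> g) x" if "x \<in> T" for x
      using frechet_derivative_at[OF D[OF that]] by (metis comp_apply)
    ultimately show "Ck_on k (\<lambda>x. frechet_derivative (f \<circ> g) (at x) v) T"
      by (rule Ck_on_cong[OF T, rotated])
  qed
qed

lemma Ck_on_bounded_linear_compose:
  assumes P: "bounded_linear P" and S: "open S"
  shows "Ck_on k f S \<Longrightarrow> Ck_on k (\<lambda>x. P (f x)) S"
proof (induction k arbitrary: f)
  case 0
  then show ?case
    using P by (simp add: bounded_linear.continuous_on)
next
  case (Suc k)
  have D: "((\<lambda>x. P (f x)) has_derivative (\<lambda>v. P (frechet_derivative f (at x) v))) (at x)"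
    if "x \<in> S" for x
    using that Suc.prems bounded_linear.has_derivative[OF P]
    by (auto simp: frechet_derivative_works)
  show ?case
    unfolding Ck_on.simps
  proof (intro conjI ballI allI)
    fix x assume "x \<in> S"
    then show "(\<lambda>x. P (f x)) differentiable (at x)"
      using D by (auto simp: differentiable_def)
  next
    fix v
    have "Ck_on k (\<lambda>x. P (frechet_derivative f (at x) v)) S"
      using Suc by simp
    moreover have "frechet_derivative (\<lambda>x. P (f x)) (at x) v = P (frechet_derivative f (at x) v)"
      if "x \<in> S" for x
      using frechet_derivative_at[OF D[OF that]] by metis
    ultimately show "Ck_on k (\<lambda>x. frechet_derivative (\<lambda>x. P (f x)) (at x) v) S"
      by (rule Ck_on_cong[OF S, rotated])
  qed
qed

lemma smooth_on_cong:
  "open S \<Longrightarrow> (\<And>x. x \<in> S \<Longrightarrow> f x = g x) \<Longrightarrow> smooth_on S g \<Longrightarrow> smooth_on S f"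
  unfolding smooth_on_def using Ck_on_cong by blast

lemma smooth_on_imp_differentiable: "smooth_on S f \<Longrightarrow> x \<in> S \<Longrightarrow> f differentiable (at x)"
  unfolding smooth_on_def by (metis Ck_on.simps(2))

lemma smooth_on_imp_differentiable_dir_deriv:
  assumes "smooth_on S f" "x \<in> S"
  shows "(\<lambda>y. dir_deriv f y v) differentiable (at x)"
proof -
  have "Ck_on (Suc (Suc 0)) f S"
    using assms by (simp add: smooth_on_def del: Ck_on.simps)
  then show ?thesis
    using assms by (simp add: dir_deriv_def)
qed

lemma smooth_on_compose_affine:
  fixes L :: "'a::euclidean_space \<Rightarrow> 'b::euclidean_space"
  assumes "\<And>x. (g has_derivative L) (at x)" "open T" "g ` T \<subseteq> S" "smooth_on S f"
  shows "smooth_on T (f \<circ> g)"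
  using Ck_on_compose_affine[OF assms(1-3)] assms(4) unfolding smooth_on_def by blast

lemma smooth_on_bounded_linear_compose:
  "bounded_linear P \<Longrightarrow> open S \<Longrightarrow> smooth_on S f \<Longrightarrow> smooth_on S (\<lambda>x. P (f x))"
  unfolding smooth_on_def using Ck_on_bounded_linear_compose by blast

lemma has_derivative_compose_fst:
  assumes "f differentiable (at (fst z))"
  shows "((\<lambda>z. f (fst z)) has_derivative (\<lambda>u. dir_deriv f (fst z) (fst u))) (at z)"
  using has_derivative_compose[OF has_derivative_fst[OF has_derivative_ident]
      has_derivative_dir_deriv[OF assms]] .

lemma has_derivative_compose_snd:
  assumes "f differentiable (at (snd z))"
  shows "((\<lambda>z. f (snd z)) has_derivative (\<lambda>u. dir_deriv f (snd z) (snd u))) (at z)"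
  using has_derivative_compose[OF has_derivative_snd[OF has_derivative_ident]
      has_derivative_dir_deriv[OF assms]] .

section \<open>Nondegenerate bilinear forms depending on a parameter\<close>

text \<open>The form \<open>b z\<close> read as a vector by means of the Euclidean inner product.
  Nondegeneracy of \<open>b\<close> thereby becomes injectivity of a linear endomorphism, hence
  bijectivity.\<close>

definition lowering :: "('e::euclidean_space \<Rightarrow> 'e \<Rightarrow> real) \<Rightarrow> 'e \<Rightarrow> 'e" where
  "lowering b z = (\<Sum>e\<in>Basis. b z e *\<^sub>R e)"

lemma lowering_inner: "e \<in> Basis \<Longrightarrow> lowering b z \<bullet> e = b z e"
  by (simp add: lowering_def)

lemma linear_lowering: "bilinear b \<Longrightarrow> linear (lowering b)"
  unfolding lowering_def[abs_def]
  by (intro linear_compose_sum ballI linearI)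
     (simp_all add: bilinear_ladd bilinear_lmul scaleR_add_left)

lemma lowering_eq_iff:
  assumes b: "bilinear b" and L: "linear L"
  shows "lowering b z = (\<Sum>e\<in>Basis. L e *\<^sub>R e) \<longleftrightarrow> (\<forall>w. b z w = L w)"
proof
  assume *: "lowering b z = (\<Sum>e\<in>Basis. L e *\<^sub>R e)"
  have "b z e = L e" if "e \<in> Basis" for e
    using lowering_inner[OF that, of b z] that by (simp add: *)
  moreover have "linear (b z)"
    using b by (simp add: bilinear_def)
  ultimately have "b z = L"
    using L linear_eq_stdbasis by blast
  then show "\<forall>w. b z w = L w" by simp
qed (simp add: lowering_def)

lemma inj_lowering:
  fixes b :: "'e::euclidean_space \<Rightarrow> 'e \<Rightarrow> real"
  assumes b: "bilinear b" and nd: "\<And>u. (\<And>v. b u v = 0) \<Longrightarrow> u = 0"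
  shows "inj (lowering b)"
  using lowering_eq_iff[OF b linear_zero] nd
  by (simp add: linear_injective_0[OF linear_lowering[OF b]])

lemma nondegenerate_eqI:
  fixes b :: "'e::euclidean_space \<Rightarrow> 'e \<Rightarrow> real"
  assumes b: "bilinear b" and nd: "\<And>u. (\<And>v. b u v = 0) \<Longrightarrow> u = 0"
    and eq: "\<And>w. b z w = b z' w"
  shows "z = z'"
proof -
  have "b (z - z') w = 0" for w
    using bilinear_lsub[OF b, of z z' w] eq by simp
  then have "z - z' = 0" by (rule nd)
  then show ?thesis by simp
qed

lemma nondegenerate_representation:
  fixes b :: "'e::euclidean_space \<Rightarrow> 'e \<Rightarrow> real"
  assumes b: "bilinear b" and nd: "\<And>u. (\<And>v. b u v = 0) \<Longrightarrow> u = 0" and L: "linear L"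
  shows "\<exists>z. \<forall>w. b z w = L w"
  using linear_injective_imp_surjective[OF linear_lowering[OF b] inj_lowering[OF b nd]]
    lowering_eq_iff[OF b L] by (metis surjD)

text \<open>
  With \<open>S\<close> the inverse of the lowering map at \<open>x0\<close>, the increment of \<open>z\<close> differs from the
  differentiable function \<open>q\<close> by \<open>o(1)\<close> times itself.
\<close>

lemma differentiable_representation:
  fixes b :: "'a::real_normed_vector \<Rightarrow> 'e::euclidean_space \<Rightarrow> 'e \<Rightarrow> real"
  assumes U: "open U" "x0 \<in> U" and b: "\<And>x. x \<in> U \<Longrightarrow> bilinear (b x)"
    and nd: "\<And>u. (\<And>v. b x0 u v = 0) \<Longrightarrow> u = 0"
    and db: "\<And>u v. (\<lambda>x. b x u v) differentiable (at x0)"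
    and dL: "\<And>w. (\<lambda>x. L x w) differentiable (at x0)"
    and eq: "\<And>x w. x \<in> U \<Longrightarrow> b x (z x) w = L x w"
  shows "z differentiable (at x0)"
proof -
  have lin: "linear (lowering (b x0))" and inj: "inj (lowering (b x0))"
    using linear_lowering inj_lowering[OF _ nd] b U by auto
  obtain S where S: "linear S" "S \<circ> lowering (b x0) = id"
    using linear_injective_left_inverse[OF lin inj] by blast
  obtain M where M: "M > 0" "\<And>y. norm (S y) \<le> M * norm y"
    using linear_bounded_pos[OF S(1)] by blast
  define d where "d x = (\<Sum>e\<in>Basis. \<Sum>e'\<in>Basis. \<bar>b x e' e - b x0 e' e\<bar>)" for x
  have "isCont (\<lambda>x. b x u v) x0" for u v
    using db differentiable_imp_continuous_within by blast
  then have "isCont d x0"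
    unfolding d_def[abs_def] by (intro continuous_intros)
  then have d0: "(d \<longlongrightarrow> 0) (at x0)"
    by (simp add: isCont_def d_def)
  \<comment> \<open>The defect left by the old solution \<open>z x0\<close> in the equation at
    \<open>x\<close>, solved with the form frozen at \<open>x0\<close>: one Newton step. Only
    \<open>b\<close>, \<open>L\<close> and constants occur in it, so it is visibly
    differentiable.\<close>
  define q where "q x = S (\<Sum>e\<in>Basis. (L x e - b x (z x0) e) *\<^sub>R e)" for x
  have q0: "q x0 = 0"
    using eq[OF U(2)] S(1) by (simp add: q_def linear_0)
  have "bounded_linear S"
    using S(1) linear_conv_bounded_linear by blast
  have "(\<lambda>x. \<Sum>e\<in>Basis. (L x e - b x (z x0) e) *\<^sub>R e) differentiable (at x0)"
    by (intro differentiable_sum ballI differentiable_scaleR differentiable_diff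
        differentiable_const db dL finite_Basis)
  then have "q differentiable (at x0)"
    using bounded_linear.has_derivative[OF \<open>bounded_linear S\<close>]
    unfolding q_def[abs_def] differentiable_def by blast
  then obtain Q where Q: "(q has_derivative Q) (at x0)"
    by (auto simp: differentiable_def)
  then have "bounded_linear Q"
    by (rule has_derivative_bounded_linear)
  then obtain K where K: "K > 0" "\<And>y. norm (Q y) \<le> norm y * K"
    using bounded_linear.pos_bounded by blast
  \<comment> \<open>No continuity of \<open>z\<close> is assumed. The estimate carries the unknown
    increment on its right-hand side, to be absorbed once \<open>M * d x\<close> is at most
    1/2.\<close>
  have step: "norm (z x - z x0 - q x) \<le> M * d x * norm (z x - z x0)" if x: "x \<in> U" for x
  proof -
    define w where "w = z x - z x0"
    have coord: "\<bar>b x w e - b x0 w e\<bar> \<le> (\<Sum>e'\<in>Basis. \<bar>b x e' e - b x0 e' e\<bar>) * norm w" for e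
    proof -
      have lin_diff: "linear (\<lambda>u. b x u e - b x0 u e)"
        using b[OF x] b[OF U(2)] by (auto simp: bilinear_def intro: linear_compose_sub)
      have "b x w e - b x0 w e = (\<lambda>u. b x u e - b x0 u e) (\<Sum>e'\<in>Basis. (w \<bullet> e') *\<^sub>R e')"
        by (simp add: euclidean_representation)
      also have "\<dots> = (\<Sum>e'\<in>Basis. (w \<bullet> e') * (b x e' e - b x0 e' e))"
        by (subst linear_sum[OF lin_diff]) (simp add: linear_scale[OF lin_diff])
      also have "\<bar>\<dots>\<bar> \<le> (\<Sum>e'\<in>Basis. \<bar>w \<bullet> e'\<bar> * \<bar>b x e' e - b x0 e' e\<bar>)"
        by (rule order_trans[OF sum_abs]) (simp add: abs_mult)
      also have "\<dots> \<le> (\<Sum>e'\<in>Basis. norm w * \<bar>b x e' e - b x0 e' e\<bar>)"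
        by (intro sum_mono mult_right_mono) (auto simp: Basis_le_norm)
      finally show ?thesis by (simp add: sum_distrib_left mult.commute)
    qed
    have "norm (lowering (b x) w - lowering (b x0) w)
        = norm (\<Sum>e\<in>Basis. (b x w e - b x0 w e) *\<^sub>R e)"
      by (simp add: lowering_def sum_subtractf scaleR_diff_left)
    also have "\<dots> \<le> (\<Sum>e\<in>Basis. \<bar>b x w e - b x0 w e\<bar>)"
      by (rule order_trans[OF norm_sum]) simp
    also have "\<dots> \<le> (\<Sum>e\<in>Basis. (\<Sum>e'\<in>Basis. \<bar>b x e' e - b x0 e' e\<bar>) * norm w)"
      by (intro sum_mono coord)
    also have "\<dots> = d x * norm w"
      by (simp add: d_def sum_distrib_right)
    finally have bound: "norm (lowering (b x) w - lowering (b x0) w) \<le> d x * norm w" .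
    have "S (lowering (b x) w) = q x"
      using bilinear_lsub[OF b[OF x]] eq[OF x] by (simp add: q_def lowering_def w_def)
    moreover have "S (lowering (b x0) w) = w"
      using S(2) by (metis comp_apply id_apply)
    ultimately have "w - q x = - S (lowering (b x) w - lowering (b x0) w)"
      by (simp add: linear_diff[OF S(1)])
    then have "norm (w - q x) \<le> M * norm (lowering (b x) w - lowering (b x0) w)"
      using M(2) by simp
    also have "\<dots> \<le> M * (d x * norm w)"
      using bound M(1) by simp
    finally show ?thesis by (simp add: w_def mult.assoc)
  qed
  have small: "\<exists>\<delta>>0. \<forall>x. norm (x - x0) < \<delta> \<longrightarrow>
      norm (z x - z x0 - q x) \<le> \<epsilon> * norm (x - x0)" if "\<epsilon> > 0" for \<epsilon>
  proof -
    \<comment> \<open>The bound 1/2 absorbs the increment and yields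
      \<open>W \<le> 2 * norm (q x)\<close>; as \<open>norm (q x)\<close> is at most
      \<open>K + 1\<close> times the distance to \<open>x0\<close>, the other bound turns the error
      into \<epsilon> times that distance.\<close>
    define \<eta> where "\<eta> = min (1/2) (\<epsilon> / (2 * (K + 1))) / M"
    have "\<eta> > 0"
      using that K M by (simp add: \<eta>_def)
    then obtain \<delta>1 where \<delta>1: "\<delta>1 > 0" "\<And>x. x \<noteq> x0 \<Longrightarrow> dist x x0 < \<delta>1 \<Longrightarrow> dist (d x) 0 < \<eta>"
      using d0 unfolding Lim_at by (metis zero_less_dist_iff)
    obtain \<delta>2 where \<delta>2: "\<delta>2 > 0" "\<And>x. dist x x0 < \<delta>2 \<Longrightarrow> x \<in> U"
      using U unfolding open_dist by metis
    obtain \<delta>3 where \<delta>3: "\<delta>3 > 0"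
      "\<And>x. norm (x - x0) < \<delta>3 \<Longrightarrow> norm (q x - q x0 - Q (x - x0)) \<le> 1 * norm (x - x0)"
      using Q unfolding has_derivative_at_alt by (metis zero_less_one)
    have "norm (z x - z x0 - q x) \<le> \<epsilon> * norm (x - x0)"
      if x: "norm (x - x0) < min \<delta>1 (min \<delta>2 \<delta>3)" for x
    proof (cases "x = x0")
      case False
      define W where "W = norm (z x - z x0)"
      have "d x < \<eta>"
        using \<delta>1(2)[OF False] x by (simp add: dist_norm)
      then have Md: "M * d x \<le> 1/2" "M * d x \<le> \<epsilon> / (2 * (K + 1))"
        using M(1) by (auto simp: \<eta>_def field_simps)
      have "norm (q x) \<le> norm (q x - q x0 - Q (x - x0)) + norm (Q (x - x0))"
        using q0 norm_triangle_sub[of "q x" "Q (x - x0)"] by simp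
      then have qx: "norm (q x) \<le> (K + 1) * norm (x - x0)"
        using \<delta>3(2)[of x] K(2)[of "x - x0"] x by (simp add: algebra_simps)
      have st: "norm (z x - z x0 - q x) \<le> M * d x * W"
        using step[of x] \<delta>2(2)[of x] x by (simp add: dist_norm W_def)
      also have "\<dots> \<le> 1/2 * W"
        using Md(1) by (intro mult_right_mono) (auto simp: W_def)
      finally have W: "W \<le> 2 * norm (q x)"
        using norm_triangle_sub[of "z x - z x0" "q x"] by (simp add: W_def)
      have "M * d x * W \<le> \<epsilon> / (2 * (K + 1)) * (2 * ((K + 1) * norm (x - x0)))"
        using Md(2) W qx \<open>\<epsilon> > 0\<close> K(1) by (intro mult_mono) (auto simp: W_def)
      also have "\<dots> = \<epsilon> * norm (x - x0)"
        using K(1) by (simp add: field_simps)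
      finally show ?thesis
        using st by simp
    qed (simp add: q0)
    then show ?thesis
      using \<delta>1(1) \<delta>2(1) \<delta>3(1) by (intro exI[of _ "min \<delta>1 (min \<delta>2 \<delta>3)"]) auto
  qed
  have "((\<lambda>x. z x - z x0 - q x) has_derivative (\<lambda>_. 0)) (at x0)"
    unfolding has_derivative_at_alt using small by (simp add: q0)
  from has_derivative_add[OF has_derivative_add[OF this Q] has_derivative_const[of "z x0"]]
  have "(z has_derivative Q) (at x0)" by simp
  then show ?thesis
    by (auto simp: differentiable_def)
qed

section \<open>The Levi-Civita connection of a metric in coordinates\<close>

text \<open>Twice the covector \<open>G x (christoffel G x u v)\<close>. The Lie bracket terms of
  the general Koszul formula are absent because constant fields commute.\<close>

definition koszul ::
    "('e::euclidean_space \<Rightarrow> 'e \<Rightarrow> 'e \<Rightarrow> real) \<Rightarrow> 'e \<Rightarrow> 'e \<Rightarrow> 'e \<Rightarrow> 'e \<Rightarrow> real" where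
  "koszul G x u v w =
     dir_deriv (\<lambda>y. G y v w) x u + dir_deriv (\<lambda>y. G y u w) x v - dir_deriv (\<lambda>y. G y u v) x w"

definition gradient ::
    "('e::euclidean_space \<Rightarrow> 'e \<Rightarrow> 'e \<Rightarrow> real) \<Rightarrow> ('e \<Rightarrow> real) \<Rightarrow> 'e \<Rightarrow> 'e" where
  "gradient G \<phi> x = (THE z. \<forall>w. G x z w = dir_deriv \<phi> x w)"

text \<open>Nondegeneracy makes the solution of the Koszul equation unique, so a candidate for the
  connection need only be checked against that equation.\<close>

lemma christoffel_eqI:
  assumes b: "bilinear (G x)" and nd: "\<And>u. (\<And>v. G x u v = 0) \<Longrightarrow> u = 0"
    and z: "\<And>w. 2 * G x z w = koszul G x u v w"
  shows "christoffel G x u v = z"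
  unfolding christoffel_def koszul_def[symmetric]
proof (rule the_equality)
  fix z' assume "\<forall>w. 2 * G x z' w = koszul G x u v w"
  then have "2 * G x z' w = 2 * G x z w" for w
    by (simp add: z)
  then show "z' = z"
    using nondegenerate_eqI[OF b nd] by simp
qed (simp add: z)

locale metric_field =
  fixes U :: "'e::euclidean_space set" and G :: "'e \<Rightarrow> 'e \<Rightarrow> 'e \<Rightarrow> real"
  assumes open_U: "open U"
    and bilinear: "x \<in> U \<Longrightarrow> bilinear (G x)"
    and sym: "x \<in> U \<Longrightarrow> G x u v = G x v u"
    and nondegenerate: "x \<in> U \<Longrightarrow> (\<And>v. G x u v = 0) \<Longrightarrow> u = 0"
    and smooth: "smooth_on U (\<lambda>x. G x u v)"
begin

lemma differentiable: "x \<in> U \<Longrightarrow> (\<lambda>x. G x u v) differentiable (at x)"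
  using smooth smooth_on_imp_differentiable by blast

lemma linear_dir_deriv_left:
  assumes x: "x \<in> U"
  shows "linear (\<lambda>u. dir_deriv (\<lambda>y. G y u w) x a)"
proof (rule linearI)
  note D = has_derivative_dir_deriv[OF differentiable[OF x]]
  fix u v c
  have "dir_deriv (\<lambda>y. G y (u + v) w) x a = dir_deriv (\<lambda>y. G y u w + G y v w) x a"
    using bilinear_ladd[OF bilinear] by (intro dir_deriv_cong_open[OF open_U x])
  also have "\<dots> = dir_deriv (\<lambda>y. G y u w) x a + dir_deriv (\<lambda>y. G y v w) x a"
    by (rule dir_deriv_eqI[OF has_derivative_add[OF D D]])
  finally show "dir_deriv (\<lambda>y. G y (u + v) w) x a = \<dots>" .
  have "dir_deriv (\<lambda>y. G y (c *\<^sub>R u) w) x a = dir_deriv (\<lambda>y. c *\<^sub>R G y u w) x a"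
    using bilinear_lmul[OF bilinear] by (intro dir_deriv_cong_open[OF open_U x])
  also have "\<dots> = c *\<^sub>R dir_deriv (\<lambda>y. G y u w) x a"
    by (rule dir_deriv_eqI[OF has_derivative_scaleR_right[OF D]])
  finally show "dir_deriv (\<lambda>y. G y (c *\<^sub>R u) w) x a = \<dots>" .
qed

lemma linear_dir_deriv_right:
  assumes x: "x \<in> U"
  shows "linear (\<lambda>u. dir_deriv (\<lambda>y. G y w u) x a)"
proof -
  have "dir_deriv (\<lambda>y. G y w u) x a = dir_deriv (\<lambda>y. G y u w) x a" for u
    using sym by (intro dir_deriv_cong_open[OF open_U x])
  then show ?thesis
    using linear_dir_deriv_left[OF x] by simp
qed

text \<open>No Leibniz terms arise, since the vectors stand for fields with constant coefficients.
  Linearity in \<open>w\<close> gives existence of the Christoffel vector, linearity in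
  \<open>u\<close> and \<open>v\<close> its behaviour in these arguments.\<close>

lemma linear_koszul:
  assumes x: "x \<in> U"
  shows "linear (koszul G x u v)" "linear (\<lambda>v. koszul G x u v w)"
    "linear (\<lambda>u. koszul G x u v w)"
  unfolding koszul_def[abs_def]
  by (intro linear_compose_add linear_compose_sub linear_dir_deriv_left[OF x]
      linear_dir_deriv_right[OF x] linear_dir_deriv[OF differentiable[OF x]])+

lemma christoffel_koszul:
  assumes x: "x \<in> U"
  shows "2 * G x (christoffel G x u v) w = koszul G x u v w"
proof -
  have "linear (\<lambda>w. (1/2) *\<^sub>R koszul G x u v w)"
    by (intro linear_compose_scale_right linear_koszul[OF x])
  then obtain z where "\<forall>w. G x z w = (1/2) *\<^sub>R koszul G x u v w"
    using nondegenerate_representation[OF bilinear[OF x] nondegenerate[OF x]] by blast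
  then have z: "2 * G x z w = koszul G x u v w" for w
    by (simp add: mult.commute)
  have "christoffel G x u v = z"
    by (rule christoffel_eqI[where G = G and x = x, OF bilinear[OF x] nondegenerate[OF x]])
       (simp_all add: z)
  then show ?thesis using z by simp
qed

lemma christoffel_scaleR_right:
  assumes x: "x \<in> U"
  shows "christoffel G x u (c *\<^sub>R v) = c *\<^sub>R christoffel G x u v"
  using christoffel_koszul[OF x, of u v] linear_scale[OF linear_koszul(2)[OF x]]
    bilinear_lmul[OF bilinear[OF x]]
  by (intro christoffel_eqI[where G = G and x = x, OF bilinear[OF x] nondegenerate[OF x]]) simp_all

lemma christoffel_zero [simp]:
  assumes x: "x \<in> U"
  shows "christoffel G x 0 v = 0" "christoffel G x u 0 = 0"
  using linear_0[OF linear_koszul(3)[OF x]] linear_0[OF linear_koszul(2)[OF x]]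
    bilinear_lzero[OF bilinear[OF x]]
  by (auto intro!: christoffel_eqI[where G = G and x = x, OF bilinear[OF x] nondegenerate[OF x]])

text \<open>The Christoffel vector solves a linear equation whose form is the metric and whose
  right-hand side consists of first derivatives of the metric; both are differentiable because the
  metric is smooth.\<close>

lemma differentiable_christoffel:
  assumes x: "x \<in> U"
  shows "(\<lambda>x. christoffel G x u v) differentiable (at x)"
proof (rule differentiable_representation[OF open_U x bilinear nondegenerate[OF x]])
  show "(\<lambda>x. koszul G x u v w / 2) differentiable (at x)" for w
    unfolding koszul_def divide_inverse
    using smooth_on_imp_differentiable_dir_deriv[OF smooth x]
    by (intro differentiable_mult differentiable_diff differentiable_add) auto
qed (use christoffel_koszul differentiable[OF x] in \<open>auto simp: field_simps\<close>)

lemma gradient_eq: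
  assumes x: "x \<in> U" and \<phi>: "\<phi> differentiable (at x)"
  shows "G x (gradient G \<phi> x) w = dir_deriv \<phi> x w"
proof -
  have "\<exists>!z. \<forall>w. G x z w = dir_deriv \<phi> x w"
    using nondegenerate_representation[OF bilinear[OF x] nondegenerate[OF x] linear_dir_deriv[OF \<phi>]]
      nondegenerate_eqI[OF bilinear[OF x] nondegenerate[OF x]] by metis
  from theI'[OF this] show ?thesis
    by (simp add: gradient_def)
qed

lemma differentiable_gradient:
  assumes x: "x \<in> U" and "\<And>y. y \<in> U \<Longrightarrow> \<phi> differentiable (at y)"
    and "\<And>w. (\<lambda>y. dir_deriv \<phi> y w) differentiable (at x)"
  shows "gradient G \<phi> differentiable (at x)"
  using assms gradient_eq differentiable[OF x]
  by (intro differentiable_representation[where L = "dir_deriv \<phi>" and b = G,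
        OF open_U x bilinear nondegenerate[OF x]]) auto

end

section \<open>Warped products in coordinates\<close>

text \<open>
  The multiple of the fiber metric by which the Ricci tensors of the warped product and of the
  \<open>n\<close>-dimensional fiber differ on vertical vectors.
\<close>

definition warped_ricci_coeff ::
    "('m::euclidean_space \<Rightarrow> 'm \<Rightarrow> 'm \<Rightarrow> real) \<Rightarrow> ('m \<Rightarrow> real) \<Rightarrow> nat \<Rightarrow> 'm \<Rightarrow> real" where
  "warped_ricci_coeff G \<phi> n x =
    (\<Sum>e\<in>Basis. ((dir_deriv \<phi> x e / (4 * \<phi> x)) *\<^sub>R gradient G \<phi> x
       - (1/2) *\<^sub>R (dir_deriv (gradient G \<phi>) x e + christoffel G x e (gradient G \<phi> x))) \<bullet> e)
    - dir_deriv \<phi> x (gradient G \<phi> x) / (4 * \<phi> x) * (real n - 1)"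

text \<open>\<phi> stands for the squared warping function. The form \<open>H\<close> is prescribed
  over \<open>U \<times> V\<close> only, so derivatives of expressions in \<open>H\<close> have to
  be localised to this open set. Two derivatives of \<phi> suffice, because curvature is of second
  order in the metric.\<close>

locale warped_field = B: metric_field U GB + F: metric_field V GF
  for U :: "'m::euclidean_space set" and GB and V :: "'n::euclidean_space set" and GF +
  fixes \<phi> :: "'m \<Rightarrow> real" and H :: "'m \<times> 'n \<Rightarrow> 'm \<times> 'n \<Rightarrow> 'm \<times> 'n \<Rightarrow> real"
  assumes \<phi>_pos: "x \<in> U \<Longrightarrow> \<phi> x > 0"
    and \<phi>_differentiable: "x \<in> U \<Longrightarrow> \<phi> differentiable (at x)"
    and \<phi>_differentiable2: "x \<in> U \<Longrightarrow> (\<lambda>x. dir_deriv \<phi> x a) differentiable (at x)"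
    and warped: "x \<in> U \<Longrightarrow> y \<in> V \<Longrightarrow>
      H (x, y) u v = GB x (fst u) (fst v) + \<phi> x * GF y (snd u) (snd v)"
begin

abbreviation "grad \<equiv> gradient GB \<phi>"

lemma grad_eq: "x \<in> U \<Longrightarrow> GB x (grad x) w = dir_deriv \<phi> x w"
  using B.gradient_eq \<phi>_differentiable by blast

lemma differentiable_grad: "x \<in> U \<Longrightarrow> grad differentiable (at x)"
  using B.differentiable_gradient \<phi>_differentiable \<phi>_differentiable2 by blast

lemma open_UV: "open (U \<times> V)"
  using B.open_U F.open_U open_Times by blast

lemma bilinear_warped:
  assumes "x \<in> U" "y \<in> V"
  shows "bilinear (H (x, y))"
  using assms bilinear_ladd[OF B.bilinear[OF assms(1)]] bilinear_lmul[OF B.bilinear[OF assms(1)]]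
    bilinear_radd[OF B.bilinear[OF assms(1)]] bilinear_rmul[OF B.bilinear[OF assms(1)]]
    bilinear_ladd[OF F.bilinear[OF assms(2)]] bilinear_lmul[OF F.bilinear[OF assms(2)]]
    bilinear_radd[OF F.bilinear[OF assms(2)]] bilinear_rmul[OF F.bilinear[OF assms(2)]]
  by (auto simp: bilinear_def warped algebra_simps intro!: linearI)

lemma nondegenerate_warped:
  assumes x: "x \<in> U" and y: "y \<in> V" and u: "\<And>v. H (x, y) u v = 0"
  shows "u = 0"
proof -
  have "fst u = 0"
    using u[of "(v, 0)" for v] x y bilinear_rzero[OF F.bilinear[OF y]]
    by (intro B.nondegenerate[OF x]) (simp add: warped)
  moreover have "snd u = 0"
    using u[of "(0, v)" for v] x y bilinear_rzero[OF B.bilinear[OF x]] \<phi>_pos[OF x]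
    by (intro F.nondegenerate[OF y]) (simp add: warped)
  ultimately show ?thesis
    by (simp add: prod_eq_iff)
qed

lemma dir_deriv_warped:
  assumes x: "x \<in> U" and y: "y \<in> V"
  shows "dir_deriv (\<lambda>z. H z v w) (x, y) u =
    dir_deriv (\<lambda>x. GB x (fst v) (fst w)) x (fst u)
    + dir_deriv \<phi> x (fst u) * GF y (snd v) (snd w)
    + \<phi> x * dir_deriv (\<lambda>y. GF y (snd v) (snd w)) y (snd u)"
proof -
  have "dir_deriv (\<lambda>z. H z v w) (x, y) u = dir_deriv
      (\<lambda>z. GB (fst z) (fst v) (fst w) + \<phi> (fst z) * GF (snd z) (snd v) (snd w)) (x, y) u"
    using x y by (intro dir_deriv_cong_open[OF open_UV]) (auto simp: warped)
  also have "\<dots> = dir_deriv (\<lambda>x. GB x (fst v) (fst w)) x (fst u)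
    + (\<phi> x * dir_deriv (\<lambda>y. GF y (snd v) (snd w)) y (snd u)
       + dir_deriv \<phi> x (fst u) * GF y (snd v) (snd w))"
    using dir_deriv_eqI[OF has_derivative_add[OF
        has_derivative_compose_fst[of "\<lambda>x. GB x (fst v) (fst w)" "(x, y)"]
        has_derivative_mult[OF has_derivative_compose_fst[of \<phi> "(x, y)"]
          has_derivative_compose_snd[of "\<lambda>y. GF y (snd v) (snd w)" "(x, y)"]]]]
      B.differentiable[OF x] F.differentiable[OF y] \<phi>_differentiable[OF x] by simp
  finally show ?thesis by simp
qed

text \<open>Differentiating the factor \<phi> adds three terms to the Koszul formula. Two of them
  are pairings of \<open>GF\<close> with \<open>snd w\<close> and become vertical after division by
  \<open>2 * \<phi> x\<close>. The third is linear in \<open>fst w\<close> and is therefore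
  represented by a multiple of \<open>grad x\<close>.\<close>

lemma christoffel_warped:
  assumes x: "x \<in> U" and y: "y \<in> V"
  shows "christoffel H (x, y) u v =
    (christoffel GB x (fst u) (fst v) - (GF y (snd u) (snd v) / 2) *\<^sub>R grad x,
     christoffel GF y (snd u) (snd v) + (dir_deriv \<phi> x (fst u) / (2 * \<phi> x)) *\<^sub>R snd v
       + (dir_deriv \<phi> x (fst v) / (2 * \<phi> x)) *\<^sub>R snd u)"
proof (rule christoffel_eqI[where G = H, OF bilinear_warped[OF x y] nondegenerate_warped[OF x y]])
  fix w
  note b = bilinear_ladd bilinear_lsub bilinear_lmul
  show "2 * H (x, y) (christoffel GB x (fst u) (fst v) - (GF y (snd u) (snd v) / 2) *\<^sub>R grad x,
     christoffel GF y (snd u) (snd v) + (dir_deriv \<phi> x (fst u) / (2 * \<phi> x)) *\<^sub>R snd v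
       + (dir_deriv \<phi> x (fst v) / (2 * \<phi> x)) *\<^sub>R snd u) w = koszul H (x, y) u v w"
    (is "?lhs = _")
  proof -
    have "?lhs = koszul GB x (fst u) (fst v) (fst w) + \<phi> x * koszul GF y (snd u) (snd v) (snd w)
        + dir_deriv \<phi> x (fst u) * GF y (snd v) (snd w)
        + dir_deriv \<phi> x (fst v) * GF y (snd u) (snd w)
        - dir_deriv \<phi> x (fst w) * GF y (snd u) (snd v)"
      using \<phi>_pos[OF x]
      by (simp add: warped[OF x y] B.christoffel_koszul[OF x, symmetric]
          F.christoffel_koszul[OF y, symmetric] grad_eq[OF x]
          b[OF B.bilinear[OF x]] b[OF F.bilinear[OF y]] field_simps)
    also have "\<dots> = koszul H (x, y) u v w"
      by (simp add: koszul_def dir_deriv_warped[OF x y] algebra_simps)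
    finally show ?thesis .
  qed
qed


text \<open>Curvature and Hessian on vertical arguments differentiate the constant field
  \<open>(0, w)\<close> first. Neither the base connection nor the derivative of \<phi> along the
  second argument contributes there.\<close>

lemma christoffel_warped_vertical:
  assumes "x \<in> U" "y \<in> V"
  shows "christoffel H (x, y) u (0, w) =
    (- (GF y (snd u) w / 2) *\<^sub>R grad x,
     christoffel GF y (snd u) w + (dir_deriv \<phi> x (fst u) / (2 * \<phi> x)) *\<^sub>R w)"
  using assms linear_0[OF linear_dir_deriv[OF \<phi>_differentiable]]
  by (simp add: christoffel_warped)

section \<open>Curvature, Ricci tensor and Hessian on vertical vectors\<close>

lemma differentiable_quotient:
  assumes x: "x \<in> U"
  shows "(\<lambda>x. dir_deriv \<phi> x u / (2 * \<phi> x)) differentiable (at x)"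
  using \<phi>_pos[OF x] \<phi>_differentiable[OF x] \<phi>_differentiable2[OF x]
  by (intro differentiable_divide differentiable_mult) auto

lemma dir_deriv_christoffel_warped:
  assumes x: "x \<in> U" and y: "y \<in> V"
  shows "dir_deriv (\<lambda>z. christoffel H z u (0, w)) (x, y) (a, b) =
    (- (GF y (snd u) w / 2) *\<^sub>R dir_deriv grad x a
       - (dir_deriv (\<lambda>y. GF y (snd u) w) y b / 2) *\<^sub>R grad x,
     dir_deriv (\<lambda>y. christoffel GF y (snd u) w) y b
       + dir_deriv (\<lambda>x. dir_deriv \<phi> x (fst u) / (2 * \<phi> x)) x a *\<^sub>R w)"
proof -
  note D = has_derivative_compose_fst[of "\<lambda>x. dir_deriv \<phi> x (fst u) / (2 * \<phi> x)" "(x, y)"]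
    and Dgrad = has_derivative_compose_fst[of grad "(x, y)"]
    and DG = has_derivative_compose_snd[of "\<lambda>y. GF y (snd u) w" "(x, y)"]
    and D\<Gamma> = has_derivative_compose_snd[of "\<lambda>y. christoffel GF y (snd u) w" "(x, y)"]
  \<comment> \<open>Both components are built from functions of the base point and functions of the
    fiber point, so the product rule separates the directions \<open>a\<close> and \<open>b\<close>.
    This closed form agrees with the connection on \<open>U \<times> V\<close>, which is enough for
    equal derivatives there.\<close>
  have "((\<lambda>z. (- (GF (snd z) (snd u) w / 2) *\<^sub>R grad (fst z),
      christoffel GF (snd z) (snd u) w
        + (dir_deriv \<phi> (fst z) (fst u) / (2 * \<phi> (fst z))) *\<^sub>R w)) has_derivative
    (\<lambda>c. (- (GF y (snd u) w / 2) *\<^sub>R dir_deriv grad x (fst c)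
       + (- (dir_deriv (\<lambda>y. GF y (snd u) w) y (snd c) / 2)) *\<^sub>R grad x,
     dir_deriv (\<lambda>y. christoffel GF y (snd u) w) y (snd c)
       + dir_deriv (\<lambda>x. dir_deriv \<phi> x (fst u) / (2 * \<phi> x)) x (fst c) *\<^sub>R w))) (at (x, y))"
    using x y has_derivative_Pair[OF
        has_derivative_scaleR[OF has_derivative_mult_right[OF DG, of "- (1/2)"] Dgrad]
        has_derivative_add[OF D\<Gamma> has_derivative_scaleR_left[OF D]], of w]
      F.differentiable F.differentiable_christoffel differentiable_grad differentiable_quotient[OF x]
    by simp
  from dir_deriv_eqI[OF this, of "(a, b)"] show ?thesis
    using x y
    by (subst dir_deriv_cong_open[OF open_UV]) (auto simp: christoffel_warped_vertical)
qed

text \<open>The horizontal half of the Ricci trace. The summand with \<open>4 * \<phi> x\<close>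
  comes from differentiating along \<open>(a, 0)\<close> first and along \<open>(0, v)\<close>
  second, the other from the opposite order. With \<phi> = f^2 the bracket is minus f times the
  covariant derivative of grad f along \<open>a\<close>.\<close>

lemma curvature_warped_horizontal:
  assumes x: "x \<in> U" and y: "y \<in> V"
  shows "fst (curvature H (x, y) (a, 0) (0, v) (0, w)) = GF y v w *\<^sub>R
    ((dir_deriv \<phi> x a / (4 * \<phi> x)) *\<^sub>R grad x
     - (1/2) *\<^sub>R (dir_deriv grad x a + christoffel GB x a (grad x)))"
proof -
  have z: "GF y 0 w = 0" "dir_deriv (\<lambda>y. GF y 0 w) y v = 0" "dir_deriv grad x 0 = 0"
    "dir_deriv (\<lambda>y. GF y v w) y 0 = 0"
    using linear_0[OF linear_dir_deriv[OF F.differentiable[OF y]]] bilinear_lzero[OF F.bilinear[OF y]] linear_0[OF F.linear_dir_deriv_left[OF y]]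
      linear_0[OF linear_dir_deriv[OF differentiable_grad[OF x]]] by auto
  show ?thesis
    using x y z bilinear_rmul[OF F.bilinear[OF y]] bilinear_rzero[OF F.bilinear[OF y]]
      bilinear_lzero[OF F.bilinear[OF y]] B.christoffel_scaleR_right[OF x, of a "- (GF y v w / 2)" "grad x"]
    by (simp add: curvature_def dir_deriv_christoffel_warped christoffel_warped_vertical
        christoffel_warped algebra_simps)
qed

text \<open>A Gauss equation: the fiber over \<open>x\<close> is totally umbilic, since the
  horizontal part of the connection on vertical fields is a multiple of \<open>GF\<close>. With
  \<phi> = f^2 the factor of the correction is |grad f|^2.\<close>

lemma curvature_warped_vertical:
  assumes x: "x \<in> U" and y: "y \<in> V"
  shows "snd (curvature H (x, y) (0, a) (0, v) (0, w)) = curvature GF y a v w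
     - (dir_deriv \<phi> x (grad x) / (4 * \<phi> x)) *\<^sub>R (GF y v w *\<^sub>R a - GF y a w *\<^sub>R v)"
proof -
  note z = linear_dir_deriv[OF \<phi>_differentiable[OF x]]
    linear_dir_deriv[OF differentiable_quotient[OF x, of 0]]
  show ?thesis
    using x y linear_0[OF z(1)] linear_0[OF z(2)] linear_scale[OF z(1)] linear_neg[OF z(1)]
      linear_0[OF linear_dir_deriv[OF differentiable_grad[OF x]]]
    by (simp add: curvature_def dir_deriv_christoffel_warped christoffel_warped_vertical
        christoffel_warped algebra_simps)
qed

text \<open>The basis of the product splits into horizontal and vertical vectors, and so does the
  trace. Each half is known from the corresponding component of the curvature.\<close>

lemma ricci_warped_vertical:
  assumes x: "x \<in> U" and y: "y \<in> V"
  shows "ricci H (x, y) (0, v) (0, w) = ricci GF y v w + warped_ricci_coeff GB \<phi> DIM('n) x * GF y v w"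
proof -
  have lin: "linear (\<lambda>a. GF y a w)"
    using F.bilinear[OF y] by (simp add: bilinear_def)
  \<comment> \<open>The trace of the rank-one map sending \<open>a\<close> to
    \<open>GF y a w *\<^sub>R v\<close>. The basis is orthonormal for the Euclidean inner product
    and in general not for \<open>GF\<close>.\<close>
  have tr: "(\<Sum>e\<in>Basis. GF y e w * (v \<bullet> e)) = GF y v w"
    using linear_sum[OF lin, of "\<lambda>e. (v \<bullet> e) *\<^sub>R e" Basis]
    by (simp add: linear_scale[OF lin] euclidean_representation mult.commute)
  define c where "c = dir_deriv \<phi> x (grad x) / (4 * \<phi> x)"
  have "(\<Sum>e\<in>Basis. snd (curvature H (x, y) (0, e) (0, v) (0, w)) \<bullet> e)
    = (\<Sum>e\<in>Basis. curvature GF y e v w \<bullet> e - c * (GF y v w - GF y e w * (v \<bullet> e)))"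
    by (intro sum.cong refl)
       (simp add: curvature_warped_vertical[OF x y] inner_diff_left c_def)
  \<comment> \<open>The identity part of the correction has trace \<open>DIM('n)\<close>, the
    rank-one part removes one: hence the factor n - 1 in the coefficient.\<close>
  also have "\<dots> = ricci GF y v w - c * (real DIM('n) * GF y v w - GF y v w)"
    by (simp add: sum_subtractf sum_distrib_left[symmetric] tr ricci_def)
  finally have "(\<Sum>e\<in>Basis. snd (curvature H (x, y) (0, e) (0, v) (0, w)) \<bullet> e) = \<dots>" .
  moreover have "(\<Sum>e\<in>Basis. fst (curvature H (x, y) (e, 0) (0, v) (0, w)) \<bullet> e)
    = GF y v w * (\<Sum>e\<in>Basis. ((dir_deriv \<phi> x e / (4 * \<phi> x)) *\<^sub>R grad x
       - (1/2) *\<^sub>R (dir_deriv grad x e + christoffel GB x e (grad x))) \<bullet> e)"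
    by (simp add: curvature_warped_horizontal[OF x y] sum_distrib_left)
  moreover have "ricci H (x, y) (0, v) (0, w)
    = (\<Sum>e\<in>Basis. fst (curvature H (x, y) (e, 0) (0, v) (0, w)) \<bullet> e)
      + (\<Sum>e\<in>Basis. snd (curvature H (x, y) (0, e) (0, v) (0, w)) \<bullet> e)"
    unfolding ricci_def Basis_prod_def
    by (subst sum.union_disjoint) (auto simp: sum.reindex inj_on_def inner_prod_def)
  ultimately show ?thesis
    by (simp add: warped_ricci_coeff_def c_def algebra_simps)
qed

text \<open>The lifted potential is constant along vertical directions, so only the connection term
  of the Hessian survives, and of it only the horizontal part, a multiple of
  \<open>grad x\<close>.\<close>

lemma hessian_warped_vertical:
  assumes x: "x \<in> U" and y: "y \<in> V"
    and h: "\<And>x. x \<in> U \<Longrightarrow> h differentiable (at x)"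
  shows "hessian H (h \<circ> fst) (x, y) (0, v) (0, w) = dir_deriv h x (grad x) / 2 * GF y v w"
proof -
  have D: "dir_deriv (h \<circ> fst) (a, b) c = dir_deriv h a (fst c)" if "a \<in> U" for a c and b :: 'n
    using dir_deriv_eqI[OF has_derivative_compose_fst[of h "(a, b)"], of c] h[OF that]
    by (simp add: comp_def)
  have "dir_deriv (\<lambda>z. dir_deriv (h \<circ> fst) z (0, w)) (x, y) (0, v)
      = dir_deriv (\<lambda>_. 0) (x, y) (0, v)"
    using x y D linear_0[OF linear_dir_deriv[OF h]]
    by (intro dir_deriv_cong_open[OF open_UV]) auto
  also have "\<dots> = 0"
    by (simp add: dir_deriv_def)
  finally have "dir_deriv (\<lambda>z. dir_deriv (h \<circ> fst) z (0, w)) (x, y) (0, v) = 0" .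
  then show ?thesis
    using linear_scale[OF linear_dir_deriv[OF h[OF x]], of "- (GF y v w / 2)" "grad x"]
    by (simp add: hessian_def D[OF x] christoffel_warped_vertical[OF x y])
qed

end

section \<open>Charts of a manifold and of a product\<close>

lemma is_chart_inv:
  assumes "is_chart c"
  shows "p \<in> chart_dom c \<Longrightarrow> chart_inv c (chart_map c p) = p"
    and "x \<in> chart_map c ` chart_dom c \<Longrightarrow> chart_map c (chart_inv c x) = x"
    and "x \<in> chart_map c ` chart_dom c \<Longrightarrow> chart_inv c x \<in> chart_dom c"
  using assms by (auto simp: is_chart_def homeomorphism_def)

lemma open_chart_image:
  assumes c: "is_chart c" and W: "open W"
  shows "open (chart_map c ` (chart_dom c \<inter> W))"
proof -
  have "chart_map c ` (chart_dom c \<inter> W) = chart_map c ` chart_dom c \<inter> chart_inv c -` W"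
    using is_chart_inv[OF c] by (auto simp: image_iff)
  moreover have "continuous_on (chart_map c ` chart_dom c) (chart_inv c)"
    "open (chart_map c ` chart_dom c)"
    using c by (auto simp: is_chart_def homeomorphism_def)
  ultimately show ?thesis
    using W by (metis continuous_on_open_vimage inf_commute)
qed

section \<open>Coordinate vectors as derivations, and metrics in a chart\<close>

lemma smooth_near_differentiable:
  assumes "c \<in> A" "p \<in> chart_dom c" "smooth_near A p \<phi>"
  shows "(\<phi> \<circ> chart_inv c) differentiable (at (chart_map c p))"
  using assms smooth_on_imp_differentiable unfolding smooth_near_def by blast

text \<open>An equation of functions on all \<phi>, including those not smooth near
  \<open>p\<close>, where both sides are 0. In this form it fits the bilinearity clause of
  \<open>semi_riemannian\<close>.\<close>

lemma linear_coord_vec: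
  assumes "c \<in> A" "p \<in> chart_dom c"
  shows "coord_vec A c p (a *\<^sub>R u + b *\<^sub>R v) = (\<lambda>\<phi>. a * coord_vec A c p u \<phi> + b * coord_vec A c p v \<phi>)"
  using linear_frechet_derivative[OF smooth_near_differentiable[OF assms]]
  by (auto simp: coord_vec_def linear_add linear_scale)

lemma smooth_near_coordinate:
  assumes A: "smooth_atlas A" and c: "c \<in> A" and p: "p \<in> chart_dom c"
  shows "smooth_near A p (\<lambda>q. chart_map c q \<bullet> b)"
  unfolding smooth_near_def
proof (intro exI[of _ "chart_dom c"] conjI ballI)
  show "open (chart_dom c)"
    using A c by (auto simp: smooth_atlas_def is_chart_def)
  fix d assume d: "d \<in> A"
  have "open (chart_map d ` (chart_dom d \<inter> chart_dom c))"
    using A d \<open>open (chart_dom c)\<close> open_chart_image unfolding smooth_atlas_def by blast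
  moreover have "smooth_on (chart_map d ` (chart_dom d \<inter> chart_dom c)) (chart_map c \<circ> chart_inv d)"
    using A c d by (auto simp: smooth_atlas_def)
  ultimately have "smooth_on (chart_map d ` (chart_dom d \<inter> chart_dom c))
      (\<lambda>x. (chart_map c \<circ> chart_inv d) x \<bullet> b)"
    using smooth_on_bounded_linear_compose[OF bounded_linear_inner_left] by blast
  then show "smooth_on (chart_map d ` (chart_dom d \<inter> chart_dom c))
      ((\<lambda>q. chart_map c q \<bullet> b) \<circ> chart_inv d)"
    by (simp add: comp_def)
qed (fact p)

text \<open>Coordinate functions are admissible test functions and read off the components of a
  coordinate vector, so the vector \<open>u\<close> is determined by its derivation.\<close>

lemma coord_vec_coordinate:
  assumes A: "smooth_atlas A" and c: "c \<in> A" and p: "p \<in> chart_dom c"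
  shows "coord_vec A c p u (\<lambda>q. chart_map c q \<bullet> b) = u \<bullet> b"
proof -
  have chart: "is_chart c"
    using A c by (auto simp: smooth_atlas_def)
  then have "open (chart_map c ` chart_dom c)"
    by (simp add: is_chart_def)
  then have "frechet_derivative ((\<lambda>q. chart_map c q \<bullet> b) \<circ> chart_inv c) (at (chart_map c p))
      = frechet_derivative (\<lambda>x. x \<bullet> b) (at (chart_map c p))"
    using p is_chart_inv[OF chart] by (intro frechet_derivative_cong_open) auto
  also have "\<dots> = (\<lambda>x. x \<bullet> b)"
    by (intro frechet_derivative_at[symmetric] derivative_eq_intros) auto
  finally show ?thesis
    using smooth_near_coordinate[OF assms] by (simp add: coord_vec_def)
qed

text \<open>The chain rule. \<open>tangent_space\<close> collects vectors from all charts around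
  \<open>p\<close>, while \<open>metric_in\<close> sees those of a single chart; this lemma shows
  that one chart already gives them all.\<close>

lemma coord_vec_change:
  assumes A: "smooth_atlas A" and c: "c \<in> A" "p \<in> chart_dom c" and d: "d \<in> A" "p \<in> chart_dom d"
  shows "coord_vec A d p u = coord_vec A c p
    (frechet_derivative (chart_map c \<circ> chart_inv d) (at (chart_map d p)) u)"
proof
  fix \<phi>
  have charts: "is_chart c" "is_chart d"
    using A c d by (auto simp: smooth_atlas_def)
  define S where "S = chart_map d ` (chart_dom d \<inter> chart_dom c)"
  have S: "open S" "chart_map d p \<in> S"
    using open_chart_image[OF charts(2)] charts(1) c d by (auto simp: S_def is_chart_def)
  have "smooth_on S (chart_map c \<circ> chart_inv d)"
    using A c d by (auto simp: smooth_atlas_def S_def)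
  then have D: "((chart_map c \<circ> chart_inv d) has_derivative
      frechet_derivative (chart_map c \<circ> chart_inv d) (at (chart_map d p))) (at (chart_map d p))"
    using S(2) smooth_on_imp_differentiable frechet_derivative_works by blast
  show "coord_vec A d p u \<phi> = coord_vec A c p
    (frechet_derivative (chart_map c \<circ> chart_inv d) (at (chart_map d p)) u) \<phi>"
  proof (cases "smooth_near A p \<phi>")
    case True
    have "((\<phi> \<circ> chart_inv c) has_derivative
        frechet_derivative (\<phi> \<circ> chart_inv c) (at (chart_map c p))) (at (chart_map c p))"
      using smooth_near_differentiable[OF c True] frechet_derivative_works by blast
    then have "(((\<phi> \<circ> chart_inv c) \<circ> (chart_map c \<circ> chart_inv d)) has_derivative
        frechet_derivative (\<phi> \<circ> chart_inv c) (at (chart_map c p)) \<circ>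
        frechet_derivative (chart_map c \<circ> chart_inv d) (at (chart_map d p))) (at (chart_map d p))"
      using is_chart_inv(1)[OF charts(2) d(2)] by (intro diff_chain_at[OF D]) simp
    note this[THEN frechet_derivative_at]
    moreover have "frechet_derivative (\<phi> \<circ> chart_inv d) (at (chart_map d p))
        = frechet_derivative ((\<phi> \<circ> chart_inv c) \<circ> (chart_map c \<circ> chart_inv d)) (at (chart_map d p))"
      using is_chart_inv[OF charts(1)] is_chart_inv[OF charts(2)]
      by (intro frechet_derivative_cong_open[OF S]) (auto simp: S_def)
    ultimately show ?thesis
      using True by (metis (no_types, lifting) comp_apply coord_vec_def)
  qed (simp add: coord_vec_def)
qed

lemma metric_field_metric_in:
  assumes g: "semi_riemannian A g" and c: "c \<in> A"
  shows "metric_field (chart_map c ` chart_dom c) (metric_in A g c)"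
proof
  have A: "smooth_atlas A" and chart: "is_chart c"
    using g c by (auto simp: semi_riemannian_def smooth_atlas_def)
  show "open (chart_map c ` chart_dom c)"
    using chart by (simp add: is_chart_def)
  show "smooth_on (chart_map c ` chart_dom c) (\<lambda>x. metric_in A g c x u v)" for u v
    using g c by (simp add: semi_riemannian_def)
  fix x assume x: "x \<in> chart_map c ` chart_dom c"
  define p where "p = chart_inv c x"
  have p: "p \<in> chart_dom c"
    using is_chart_inv(3)[OF chart x] by (simp add: p_def)
  have G: "metric_in A g c x u v = g p (coord_vec A c p u) (coord_vec A c p v)" for u v
    by (simp add: metric_in_def p_def Let_def)
  have tan: "coord_vec A c p u \<in> tangent_space A p" for u
    using c p unfolding tangent_space_def by blast
  show sym: "metric_in A g c x u v = metric_in A g c x v u" for u v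
    using g tan by (simp add: G semi_riemannian_def)
  have lin: "metric_in A g c x (a *\<^sub>R u + b *\<^sub>R v) w = a * metric_in A g c x u w + b * metric_in A g c x v w"
    for a b u v w
    using g tan by (simp add: G linear_coord_vec[OF c p] semi_riemannian_def)
  have "linear (\<lambda>u. metric_in A g c x u w)" for w
    using lin[of 1 _ 1] lin[of _ _ 0] by (intro linearI) simp_all
  then show "bilinear (metric_in A g c x)"
    using sym by (simp add: bilinear_def)
  fix u assume u: "\<And>v. metric_in A g c x u v = 0"
  have "g p (coord_vec A c p u) Y = 0" if "Y \<in> tangent_space A p" for Y
  proof -
    obtain d v where "Y = coord_vec A d p v" "d \<in> A" "p \<in> chart_dom d"
      using \<open>Y \<in> tangent_space A p\<close> by (auto simp: tangent_space_def)
    then have "Y = coord_vec A c p (frechet_derivative (chart_map c \<circ> chart_inv d) (at (chart_map d p)) v)"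
      using coord_vec_change[OF A c p] by blast
    then show ?thesis
      using u by (simp add: G)
  qed
  moreover have "\<forall>X\<in>tangent_space A p. (\<forall>Y\<in>tangent_space A p. g p X Y = 0) \<longrightarrow> X = (\<lambda>_. 0)"
    using g by (simp add: semi_riemannian_def)
  ultimately have "coord_vec A c p u = (\<lambda>_. 0)"
    using tan by simp
  \<comment> \<open>Vanishing as a derivation is tested on the coordinate function in the direction
    \<open>u\<close> itself.\<close>
  then have "u \<bullet> u = 0"
    using coord_vec_coordinate[OF A c p, of u u] by simp
  then show "u = 0" by simp
qed

section \<open>Product charts and the differentials of the two projections\<close>

lemma chart_dom_prod_chart [simp]: "chart_dom (prod_chart c d) = chart_dom c \<times> chart_dom d"
  by (simp add: chart_dom_def prod_chart_def)

lemma chart_map_prod_chart [simp]: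
  "chart_map (prod_chart c d) = map_prod (chart_map c) (chart_map d)"
  by (simp add: chart_map_def prod_chart_def)

text \<open>Restricted to the image of the chart, because \<open>inv_into\<close> takes unspecified
  values elsewhere. Later uses therefore pass through congruence on open sets.\<close>

lemma chart_inv_prod_chart:
  assumes "is_chart c" "is_chart d" "x \<in> chart_map c ` chart_dom c" "y \<in> chart_map d ` chart_dom d"
  shows "chart_inv (prod_chart c d) (x, y) = (chart_inv c x, chart_inv d y)"
  unfolding chart_inv_def[of "prod_chart c d"]
proof (rule inv_into_f_eq)
  have "inj_on (chart_map c) (chart_dom c)" "inj_on (chart_map d) (chart_dom d)"
    using is_chart_inv(1) assms by (metis inj_on_inverseI)+
  then show "inj_on (chart_map (prod_chart c d)) (chart_dom (prod_chart c d))"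
    by (auto simp: inj_on_def)
qed (use assms(3,4) is_chart_inv[OF assms(1)] is_chart_inv[OF assms(2)] in auto)

text \<open>The equivalence makes the default value 0 of \<open>coord_vec\<close> occur for \<phi>
  on the base and for its lift simultaneously. It also brings smoothness of a lifted potential down
  to the base.\<close>

lemma smooth_near_prod_fst:
  fixes A :: "('p::{t2_space, second_countable_topology}, 'e::euclidean_space) chart set"
    and A' :: "('q::{t2_space, second_countable_topology}, 'k::euclidean_space) chart set"
  assumes A: "smooth_atlas A" and A': "smooth_atlas A'"
  shows "smooth_near (prod_atlas A A') (p, q) (\<phi> \<circ> fst) \<longleftrightarrow> smooth_near A p \<phi>"
proof
  assume "smooth_near A p \<phi>"
  then obtain W where W: "open W" "p \<in> W"
    "\<And>c. c \<in> A \<Longrightarrow> smooth_on (chart_map c ` (chart_dom c \<inter> W)) (\<phi> \<circ> chart_inv c)"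
    by (auto simp: smooth_near_def)
  have "smooth_on (chart_map (prod_chart c d) ` (chart_dom (prod_chart c d) \<inter> W \<times> UNIV))
      (\<phi> \<circ> fst \<circ> chart_inv (prod_chart c d))" if c: "c \<in> A" and d: "d \<in> A'" for c d
  proof -
    have charts: "is_chart c" "is_chart d"
      using A A' c d by (auto simp: smooth_atlas_def)
    define T where "T = chart_map c ` (chart_dom c \<inter> W) \<times> chart_map d ` chart_dom d"
    have T: "open T"
      using open_chart_image[OF charts(1) W(1)] charts(2) by (simp add: T_def open_Times is_chart_def)
    have "smooth_on T ((\<phi> \<circ> chart_inv c) \<circ> fst)"
      using W(3)[OF c]
      by (intro smooth_on_compose_affine[OF has_derivative_fst[OF has_derivative_ident] T])
         (auto simp: T_def)
    then have "smooth_on T (\<phi> \<circ> fst \<circ> chart_inv (prod_chart c d))"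
      by (rule smooth_on_cong[OF T, rotated]) (auto simp: T_def chart_inv_prod_chart[OF charts])
    moreover have "chart_map (prod_chart c d) ` (chart_dom (prod_chart c d) \<inter> W \<times> UNIV) = T"
      by (auto simp: T_def image_iff)
    ultimately show ?thesis by simp
  qed
  then show "smooth_near (prod_atlas A A') (p, q) (\<phi> \<circ> fst)"
    using W(1,2) unfolding smooth_near_def prod_atlas_def
    by (intro exI[of _ "W \<times> UNIV"]) (auto simp: open_Times)
next
  assume "smooth_near (prod_atlas A A') (p, q) (\<phi> \<circ> fst)"
  then obtain W where W: "open W" "(p, q) \<in> W"
    "\<And>c d. c \<in> A \<Longrightarrow> d \<in> A' \<Longrightarrow> smooth_on (chart_map (prod_chart c d) ` (chart_dom (prod_chart c d) \<inter> W))
      (\<phi> \<circ> fst \<circ> chart_inv (prod_chart c d))"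
    unfolding smooth_near_def prod_atlas_def by blast
  obtain d where d: "d \<in> A'" "q \<in> chart_dom d"
    using A' unfolding smooth_atlas_def by blast
  \<comment> \<open>The slice of \<open>W\<close> through \<open>q\<close>. With the second
    coordinate frozen at \<open>chart_map d q\<close>, the lift becomes \<phi> in the chart
    \<open>c\<close>.\<close>
  define W' where "W' = (\<lambda>p'. (p', q)) -` W"
  have W': "open W'"
    unfolding W'_def by (intro open_vimage W continuous_intros)
  have "smooth_on (chart_map c ` (chart_dom c \<inter> W')) (\<phi> \<circ> chart_inv c)" if c: "c \<in> A" for c
  proof -
    have charts: "is_chart c" "is_chart d"
      using A A' c d by (auto simp: smooth_atlas_def)
    have T: "open (chart_map c ` (chart_dom c \<inter> W'))"
      by (rule open_chart_image[OF charts(1) W'])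
    have "smooth_on (chart_map c ` (chart_dom c \<inter> W'))
        ((\<phi> \<circ> fst \<circ> chart_inv (prod_chart c d)) \<circ> (\<lambda>x. (x, chart_map d q)))"
    proof (rule smooth_on_compose_affine[OF _ T _ W(3)[OF c d(1)]])
      show "((\<lambda>x. (x, chart_map d q)) has_derivative (\<lambda>v. (v, 0))) (at x)" for x :: 'e
        by (intro has_derivative_Pair has_derivative_ident has_derivative_const)
    qed (use d in \<open>auto simp: W'_def image_iff\<close>)
    then show ?thesis
      using d by (elim smooth_on_cong[OF T, rotated]) (auto simp: chart_inv_prod_chart[OF charts])
  qed
  then show "smooth_near A p \<phi>"
    using W W' by (auto simp: smooth_near_def W'_def intro!: exI[of _ W'])
qed

text \<open>In product charts the projection is linear, so its differential is \<open>fst\<close>;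
  the case distinction on smoothness matches the totalisation on both sides.\<close>

lemma push_forward_fst_coord_vec:
  assumes A: "smooth_atlas A" and A': "smooth_atlas A'"
    and c: "c \<in> A" "p \<in> chart_dom c" and d: "d \<in> A'" "q \<in> chart_dom d"
  shows "push_forward fst (coord_vec (prod_atlas A A') (prod_chart c d) (p, q) u)
    = coord_vec A c p (fst u)"
proof
  fix \<phi>
  have charts: "is_chart c" "is_chart d"
    using A A' c d by (auto simp: smooth_atlas_def)
  show "push_forward fst (coord_vec (prod_atlas A A') (prod_chart c d) (p, q) u) \<phi>
    = coord_vec A c p (fst u) \<phi>"
  proof (cases "smooth_near A p \<phi>")
    case True
    let ?T = "chart_map c ` chart_dom c \<times> chart_map d ` chart_dom d"
    have "frechet_derivative (\<phi> \<circ> fst \<circ> chart_inv (prod_chart c d)) (at (chart_map c p, chart_map d q)) u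
      = dir_deriv (\<lambda>z. (\<phi> \<circ> chart_inv c) (fst z)) (chart_map c p, chart_map d q) u"
      unfolding dir_deriv_def
      using charts c d by (subst frechet_derivative_cong_open[of ?T])
        (auto simp: is_chart_def open_Times chart_inv_prod_chart[OF charts])
    also have "\<dots> = dir_deriv (\<phi> \<circ> chart_inv c) (chart_map c p) (fst u)"
      using dir_deriv_eqI[OF has_derivative_compose_fst[of "\<phi> \<circ> chart_inv c" "(chart_map c p, chart_map d q)"]]
        smooth_near_differentiable[OF c True] by simp
    finally show ?thesis
      using True by (simp add: push_forward_def coord_vec_def smooth_near_prod_fst[OF A A'] dir_deriv_def)
  qed (simp add: push_forward_def coord_vec_def smooth_near_prod_fst[OF A A'])
qed

lemma smooth_near_prod_snd:
  fixes A :: "('p::{t2_space, second_countable_topology}, 'e::euclidean_space) chart set"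
    and A' :: "('q::{t2_space, second_countable_topology}, 'k::euclidean_space) chart set"
  assumes A: "smooth_atlas A" and A': "smooth_atlas A'"
  shows "smooth_near (prod_atlas A A') (p, q) (\<phi> \<circ> snd) \<longleftrightarrow> smooth_near A' q \<phi>"
proof
  assume "smooth_near A' q \<phi>"
  then obtain W where W: "open W" "q \<in> W"
    "\<And>d. d \<in> A' \<Longrightarrow> smooth_on (chart_map d ` (chart_dom d \<inter> W)) (\<phi> \<circ> chart_inv d)"
    by (auto simp: smooth_near_def)
  have "smooth_on (chart_map (prod_chart c d) ` (chart_dom (prod_chart c d) \<inter> UNIV \<times> W))
      (\<phi> \<circ> snd \<circ> chart_inv (prod_chart c d))" if c: "c \<in> A" and d: "d \<in> A'" for c d
  proof -
    have charts: "is_chart c" "is_chart d"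
      using A A' c d by (auto simp: smooth_atlas_def)
    define T where "T = chart_map c ` chart_dom c \<times> chart_map d ` (chart_dom d \<inter> W)"
    have T: "open T"
      using open_chart_image[OF charts(2) W(1)] charts(1) by (simp add: T_def open_Times is_chart_def)
    have "smooth_on T ((\<phi> \<circ> chart_inv d) \<circ> snd)"
      using W(3)[OF d]
      by (intro smooth_on_compose_affine[OF has_derivative_snd[OF has_derivative_ident] T])
         (auto simp: T_def)
    then have "smooth_on T (\<phi> \<circ> snd \<circ> chart_inv (prod_chart c d))"
      by (rule smooth_on_cong[OF T, rotated]) (auto simp: T_def chart_inv_prod_chart[OF charts])
    moreover have "chart_map (prod_chart c d) ` (chart_dom (prod_chart c d) \<inter> UNIV \<times> W) = T"
      by (auto simp: T_def image_iff)
    ultimately show ?thesis by simp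
  qed
  then show "smooth_near (prod_atlas A A') (p, q) (\<phi> \<circ> snd)"
    using W(1,2) unfolding smooth_near_def prod_atlas_def
    by (intro exI[of _ "UNIV \<times> W"]) (auto simp: open_Times)
next
  assume "smooth_near (prod_atlas A A') (p, q) (\<phi> \<circ> snd)"
  then obtain W where W: "open W" "(p, q) \<in> W"
    "\<And>c d. c \<in> A \<Longrightarrow> d \<in> A' \<Longrightarrow> smooth_on (chart_map (prod_chart c d) ` (chart_dom (prod_chart c d) \<inter> W))
      (\<phi> \<circ> snd \<circ> chart_inv (prod_chart c d))"
    unfolding smooth_near_def prod_atlas_def by blast
  obtain c where c: "c \<in> A" "p \<in> chart_dom c"
    using A unfolding smooth_atlas_def by blast
  define W' where "W' = (\<lambda>q'. (p, q')) -` W"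
  have W': "open W'"
    unfolding W'_def by (intro open_vimage W continuous_intros)
  \<comment> \<open>Now the first coordinate is frozen at \<open>chart_map c p\<close>, for a fixed
    chart \<open>c\<close> around \<open>p\<close>.\<close>
  have "smooth_on (chart_map d ` (chart_dom d \<inter> W')) (\<phi> \<circ> chart_inv d)" if d: "d \<in> A'" for d
  proof -
    have charts: "is_chart c" "is_chart d"
      using A A' c d by (auto simp: smooth_atlas_def)
    have T: "open (chart_map d ` (chart_dom d \<inter> W'))"
      by (rule open_chart_image[OF charts(2) W'])
    have "smooth_on (chart_map d ` (chart_dom d \<inter> W'))
        ((\<phi> \<circ> snd \<circ> chart_inv (prod_chart c d)) \<circ> (\<lambda>x. (chart_map c p, x)))"
    proof (rule smooth_on_compose_affine[OF _ T _ W(3)[OF c(1) d]])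
      show "((\<lambda>x. (chart_map c p, x)) has_derivative (\<lambda>v. (0, v))) (at x)" for x :: 'k
        by (intro has_derivative_Pair has_derivative_ident has_derivative_const)
    qed (use c in \<open>auto simp: W'_def image_iff\<close>)
    then show ?thesis
      using c by (elim smooth_on_cong[OF T, rotated]) (auto simp: chart_inv_prod_chart[OF charts])
  qed
  then show "smooth_near A' q \<phi>"
    using W W' by (auto simp: smooth_near_def W'_def intro!: exI[of _ W'])
qed

lemma push_forward_snd_coord_vec:
  assumes A: "smooth_atlas A" and A': "smooth_atlas A'"
    and c: "c \<in> A" "p \<in> chart_dom c" and d: "d \<in> A'" "q \<in> chart_dom d"
  shows "push_forward snd (coord_vec (prod_atlas A A') (prod_chart c d) (p, q) u)
    = coord_vec A' d q (snd u)"
proof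
  fix \<phi>
  have charts: "is_chart c" "is_chart d"
    using A A' c d by (auto simp: smooth_atlas_def)
  show "push_forward snd (coord_vec (prod_atlas A A') (prod_chart c d) (p, q) u) \<phi>
    = coord_vec A' d q (snd u) \<phi>"
  proof (cases "smooth_near A' q \<phi>")
    case True
    let ?T = "chart_map c ` chart_dom c \<times> chart_map d ` chart_dom d"
    have "frechet_derivative (\<phi> \<circ> snd \<circ> chart_inv (prod_chart c d)) (at (chart_map c p, chart_map d q)) u
      = dir_deriv (\<lambda>z. (\<phi> \<circ> chart_inv d) (snd z)) (chart_map c p, chart_map d q) u"
      unfolding dir_deriv_def
      using charts c d by (subst frechet_derivative_cong_open[of ?T])
        (auto simp: is_chart_def open_Times chart_inv_prod_chart[OF charts])
    also have "\<dots> = dir_deriv (\<phi> \<circ> chart_inv d) (chart_map d q) (snd u)"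
      using dir_deriv_eqI[OF has_derivative_compose_snd[of "\<phi> \<circ> chart_inv d" "(chart_map c p, chart_map d q)"]]
        smooth_near_differentiable[OF d True] by simp
    finally show ?thesis
      using True by (simp add: push_forward_def coord_vec_def smooth_near_prod_snd[OF A A'] dir_deriv_def)
  qed (simp add: push_forward_def coord_vec_def smooth_near_prod_snd[OF A A'])
qed


section \<open>The warped product metric in product charts\<close>

lemma metric_in_warped:
  assumes A: "smooth_atlas A" and A': "smooth_atlas A'" and c: "c \<in> A" and d: "d \<in> A'"
    and x: "x \<in> chart_map c ` chart_dom c" and y: "y \<in> chart_map d ` chart_dom d"
  shows "metric_in (prod_atlas A A') (warped_metric g f g') (prod_chart c d) (x, y) u v =
    metric_in A g c x (fst u) (fst v) + (f (chart_inv c x))\<^sup>2 * metric_in A' g' d y (snd u) (snd v)"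
proof -
  have charts: "is_chart c" "is_chart d"
    using A A' c d by (auto simp: smooth_atlas_def)
  have "chart_inv c x \<in> chart_dom c" "chart_inv d y \<in> chart_dom d"
    using is_chart_inv(3) charts x y by blast+
  then show ?thesis
    by (simp add: metric_in_def Let_def warped_metric_def chart_inv_prod_chart[OF charts x y]
        push_forward_fst_coord_vec[OF A A' c _ d] push_forward_snd_coord_vec[OF A A' c _ d])
qed

lemma smooth_fun_imp_smooth_near: "smooth_fun A \<phi> \<Longrightarrow> smooth_near A p \<phi>"
  unfolding smooth_fun_def smooth_near_def by (intro exI[of _ UNIV]) simp

lemma hessian_cong_open:
  assumes "open S" "x \<in> S" "\<And>y. y \<in> S \<Longrightarrow> h y = h' y"
  shows "hessian G h x u v = hessian G h' x u v"
proof -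
  have eq: "dir_deriv h y w = dir_deriv h' y w" if "y \<in> S" for y w
    using assms that by (intro dir_deriv_cong_open)
  then have "dir_deriv (\<lambda>y. dir_deriv h y v) x u = dir_deriv (\<lambda>y. dir_deriv h' y v) x u"
    by (intro dir_deriv_cong_open[OF assms(1,2)])
  then show ?thesis
    using eq[OF assms(2)] by (simp add: hessian_def)
qed

lemma warped_field_metric_in:
  assumes g: "semi_riemannian A g" and g': "semi_riemannian A' g'"
    and f: "smooth_fun A f" "\<And>p. f p > 0" and c: "c \<in> A" and d: "d \<in> A'"
  shows "warped_field (chart_map c ` chart_dom c) (metric_in A g c)
    (chart_map d ` chart_dom d) (metric_in A' g' d) (\<lambda>x. (f (chart_inv c x))\<^sup>2)
    (metric_in (prod_atlas A A') (warped_metric g f g') (prod_chart c d))"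
proof (intro warped_field.intro metric_field_metric_in g g' c d warped_field_axioms.intro)
  let ?U = "chart_map c ` chart_dom c"
  have A: "smooth_atlas A" "smooth_atlas A'"
    using g g' by (simp_all add: semi_riemannian_def)
  then have U: "open ?U"
    using c by (auto simp: smooth_atlas_def is_chart_def)
  fix x assume x: "x \<in> ?U"
  show "(f (chart_inv c x))\<^sup>2 > 0"
    using f(2)[of "chart_inv c x"] by simp
  have F: "smooth_on ?U (f \<circ> chart_inv c)"
    using f(1) c by (simp add: smooth_fun_def)
  have D: "((\<lambda>x. (f (chart_inv c x))\<^sup>2) has_derivative
      (\<lambda>a. 2 * f (chart_inv c z) * dir_deriv (f \<circ> chart_inv c) z a)) (at z)" if "z \<in> ?U" for z
    using has_derivative_power[OF has_derivative_dir_deriv[OF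
        smooth_on_imp_differentiable[OF F that]], of 2]
    by (simp add: mult_ac)
  show "(\<lambda>x. (f (chart_inv c x))\<^sup>2) differentiable (at x)"
    using D[OF x] by (auto simp: differentiable_def)
  \<comment> \<open>The first derivative of the square is an explicit product on the open set
    \<open>?U\<close>, and its factors are differentiable because \<open>f\<close> is smooth in the
    chart.\<close>
  have D2: "(\<lambda>x. 2 * (f \<circ> chart_inv c) x * dir_deriv (f \<circ> chart_inv c) x a) differentiable (at x)" for a
    using smooth_on_imp_differentiable[OF F x] smooth_on_imp_differentiable_dir_deriv[OF F x]
    by (intro differentiable_mult differentiable_const)
  show "(\<lambda>x. dir_deriv (\<lambda>x. (f (chart_inv c x))\<^sup>2) x a) differentiable (at x)" for a
    by (rule differentiable_cong_open[OF U x _ D2[of a]]) (simp add: dir_deriv_eqI[OF D])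
  fix y assume "y \<in> chart_map d ` chart_dom d"
  then show "metric_in (prod_atlas A A') (warped_metric g f g') (prod_chart c d) (x, y) u v =
      metric_in A g c x (fst u) (fst v)
      + (f (chart_inv c x))\<^sup>2 * metric_in A' g' d y (snd u) (snd v)" for u v
    by (rule metric_in_warped[OF A c d x])
qed

theorem corollary1p1:
  fixes AB :: "('b::{t2_space, second_countable_topology}, 'm::euclidean_space) chart set"
    and gB :: "'b metric"
    and AF :: "('q::{t2_space, second_countable_topology}, 'n::euclidean_space) chart set"
    and gF :: "'q metric"
    and f h :: "'b \<Rightarrow> real"
  assumes "semi_riemannian AB gB"
    and "semi_riemannian AF gF"
    and "smooth_fun AB f" and "\<And>p. f p > 0"
    and "gradient_ricci_soliton (prod_atlas AB AF) (warped_metric gB f gF) (h \<circ> fst)"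
    and "\<not> f constant_on UNIV"
  shows "einstein AF gF"
proof -
  let ?P = "prod_atlas AB AF" and ?g = "warped_metric gB f gF"
  have atlas: "smooth_atlas AB" "smooth_atlas AF"
    using assms(1,2) by (simp_all add: semi_riemannian_def)
  obtain \<rho> where \<rho>: "\<And>c z u v. c \<in> ?P \<Longrightarrow> z \<in> chart_map c ` chart_dom c \<Longrightarrow>
      ricci (metric_in ?P ?g c) z u v
      + hessian (metric_in ?P ?g c) ((h \<circ> fst) \<circ> chart_inv c) z u v
      = \<rho> * metric_in ?P ?g c z u v"
    using assms(5) unfolding gradient_ricci_soliton_def by blast
  \<comment> \<open>Smoothness of \<open>h\<close> on the base comes from smoothness of its lift,
    which is part of the soliton hypothesis.\<close>
  have h: "smooth_near AB p h" for p
    using assms(5) smooth_fun_imp_smooth_near smooth_near_prod_fst[OF atlas]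
    unfolding gradient_ricci_soliton_def by blast
  obtain c p where c: "c \<in> AB" "p \<in> chart_dom c"
    using atlas(1) unfolding smooth_atlas_def by blast
  define U where "U = chart_map c ` chart_dom c"
  define x where "x = chart_map c p"
  define \<phi> where "\<phi> = (\<lambda>x. (f (chart_inv c x))\<^sup>2)"
  \<comment> \<open>The soliton equation on vertical vectors over \<open>x\<close>, solved for the
    Ricci tensor of the fiber: \<phi> \<open>x\<close> is the factor of the vertical part of the
    metric, the other two terms are the Ricci and Hessian coefficients. No fiber chart enters, so
    one number serves all charts and points of the fiber.\<close>
  define k where "k = \<rho> * \<phi> x - warped_ricci_coeff (metric_in AB gB c) \<phi> DIM('n) x
    - dir_deriv (h \<circ> chart_inv c) x (gradient (metric_in AB gB c) \<phi> x) / 2"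
  have x: "x \<in> U"
    using c by (simp add: x_def U_def)
  have dh: "(h \<circ> chart_inv c) differentiable (at z)" if "z \<in> U" for z
    using that smooth_near_differentiable[OF c(1) _ h] by (auto simp: U_def)
  have "ricci (metric_in AF gF d) y v w = k * metric_in AF gF d y v w"
    if d: "d \<in> AF" and y: "y \<in> chart_map d ` chart_dom d" for d y v w
  proof -
    define V where "V = chart_map d ` chart_dom d"
    define H where "H = metric_in ?P ?g (prod_chart c d)"
    interpret warped_field U "metric_in AB gB c" V "metric_in AF gF d" \<phi> H
      unfolding U_def V_def \<phi>_def H_def
      by (rule warped_field_metric_in[OF assms(1-4) c(1) d])
    have y: "y \<in> V"
      using y by (simp add: V_def)
    have charts: "is_chart c" "is_chart d"
      using atlas c d by (auto simp: smooth_atlas_def)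
    have "ricci H (x, y) (0, v) (0, w)
        + hessian H ((h \<circ> fst) \<circ> chart_inv (prod_chart c d)) (x, y) (0, v) (0, w)
        = \<rho> * H (x, y) (0, v) (0, w)"
      unfolding H_def
    proof (rule \<rho>)
      show "prod_chart c d \<in> ?P"
        using c(1) d unfolding prod_atlas_def by blast
    qed (use x y in \<open>auto simp: U_def V_def\<close>)
    \<comment> \<open>The inverse of the product chart splits on \<open>U \<times> V\<close> only,
      so the two potentials agree just there; this set is open and contains
      \<open>(x, y)\<close>.\<close>
    moreover have "hessian H ((h \<circ> fst) \<circ> chart_inv (prod_chart c d)) (x, y) (0, v) (0, w)
        = hessian H ((h \<circ> chart_inv c) \<circ> fst) (x, y) (0, v) (0, w)"
      using x y by (intro hessian_cong_open[OF open_UV])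
        (auto simp: U_def V_def chart_inv_prod_chart[OF charts])
    ultimately show ?thesis
      using bilinear_lzero[OF B.bilinear[OF x]]
      by (simp add: ricci_warped_vertical[OF x y] hessian_warped_vertical[OF x y dh]
          warped[OF x y] k_def algebra_simps)
  qed
  then show ?thesis
    using assms(2) unfolding einstein_def by blast
qed

end
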